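(* For every $\gamma\ge0$ there is a constant $C_2>0$ depending only on $\gamma$ such that the following holds. Let $(\mathbf X,\mathbf Y)$ be a random element of $\mathbb R^d\times\{0,1\}^d$ with $Y_1,\dots,Y_d$ conditionally independent given $\mathbf X$, $p_j(\mathbf x)=\mathbb P(Y_j=1\mid\mathbf X=\mathbf x)$, $\mathbf p=(p_1,\dots,p_d)$, the $p_j(\mathbf X)$ being pairwise distinct with probability one. Let $\widehat{\mathbf q}:\mathbb R^d\to[0,1]^d$ be a (measurable) estimate of $\mathbf p$, and let $\widehat{\boldsymbol\delta}$ be the RankIoU segmentation rule based on $\widehat{\mathbf q}$. Then $$\mathrm{IoU}_\gamma(\boldsymbol\delta^* )-\mathrm{IoU}_\gamma(\widehat{\boldsymbol\delta})\le C_2\,\mathbb E_{\mathbf X}\|\widehat{\mathbf q}(\mathbf X)-\mathbf p(\mathbf X)\|_1,$$ where $\boldsymbol\delta^*$ is the Bayes rule for IoU-segmentation. Consequently, if $\widehat{\mathbf q}$ is computed from a training sample of size $n$ (with $d$ fixed) and $$\mathcal E_{\mathrm{CE}}(\widehat{\mathbf q}):=\mathbb E\big(l_{\mathrm{CE}}(\mathbf Y,\widehat{\mathbf q}(\mathbf X))\big)-\mathbb E\big(l_{\mathrm{CE}}(\mathbf Y,\mathbf p(\mathbf X))\big)=O_P(\epsilon_n)$$ for a sequence of positive numbers $\epsilon_n$, then $$\mathrm{IoU}_\gamma(\boldsymbol\delta^* )-\mathrm{IoU}_\gamma(\widehat{\boldsymbol\delta})=O_P\big(\sqrt d\,\ep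silon_n^{1/2}\big).$$
   Context: For measurable $\boldsymbol\delta:\mathbb R^d\to\{0,1\}^d$, $$\mathrm{IoU}_\gamma(\boldsymbol\delta)=\mathbb E\Big(\frac{\mathbf Y^\top\boldsymbol\delta(\mathbf X)+\gamma}{\|\mathbf Y\|_1+\|\boldsymbol\delta(\mathbf X)\|_1-\mathbf Y^\top\boldsymbol\delta(\mathbf X)+\gamma}\Big),\qquad 0/0:=0,$$ and the Bayes rule $\boldsymbol\delta^*$ is a global maximizer of $\mathrm{IoU}_\gamma$ over all such $\boldsymbol\delta$. The cross-entropy loss is $l_{\mathrm{CE}}(\mathbf y,\mathbf q)=-\sum_{j=1}^d\big(y_j\log q_j+(1-y_j)\log(1-q_j)\big)$. Expectations in $\mathcal E_{\mathrm{CE}}(\widehat{\mathbf q})$ and $\mathrm{IoU}_\gamma(\widehat{\boldsymbol\delta})$ are over $(\mathbf X,\mathbf Y)$ independent of the training sample, with $\widehat{\mathbf q},\widehat{\boldsymbol\delta}$ held fixed; $O_P$ refers to the randomness of the training sample as $n\to\infty$. RankIoU rule based on $\widehat{\mathbf q}$: for each $\mathbf x$, order indices so that $\widehat q_{j_1}(\mathbf x)\ge\cdots\ge\widehat q_{j_d}(\mathbf x)$, put $J_\tau(\mathbf x)=\{j_1,\dots,j_\tau\}$ and let $$\widehat\tau(\mathbf x)\in\operatorname*{argmax}_{\tau\in\{0,\dots,d\}}\Big(\sum_{j\in J_\tau(\mathbf x)}\widehat q_j(\mathbf x)+\gamma\Big)\sum_{l=0}^{d-\tau}\frac{1}{\tau+l+\gamma}\,\mathbb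 P\big(\widehat\Gamma_{-J_\tau(\mathbf x)}(\mathbf x)=l\big),$$ where $\widehat\Gamma_{-J_\tau(\mathbf x)}(\mathbf x)=\sum_{j\notin J_\tau(\mathbf x)}\widehat B_j(\mathbf x)$ and $\widehat B_j(\mathbf x)$ are independent Bernoulli variables with success probabilities $\widehat q_j(\mathbf x)$ (the objective is taken to be $0$ when $\tau=\gamma=0$). Set $\widehat\delta_j(\mathbf x)=1$ if $j\in\{j_1,\dots,j_{\widehat\tau(\mathbf x)}\}$ and $0$ otherwise (ties broken by any fixed measurable rule). *)

theory Defs
  imports "HOL-Probability.Probability"
begin

text \<open>
  The dimension d is quantified inside the statement, so vectors are functions on the index
  set \<^term>\<open>{..<d}\<close>, with the product sigma-algebras of R^d, {0,1}^d and [0,1]^d.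
  Entries of elements of {0,1}^d are real numbers.
\<close>

definition euclid :: "nat \<Rightarrow> (nat \<Rightarrow> real) measure" where
  "euclid d = PiM {..<d} (\<lambda>_. borel)"

definition bin_cube :: "nat \<Rightarrow> (nat \<Rightarrow> real) measure" where
  "bin_cube d = PiM {..<d} (\<lambda>_. count_space {0, 1})"

definition unit_cube :: "nat \<Rightarrow> (nat \<Rightarrow> real) measure" where
  "unit_cube d = PiM {..<d} (\<lambda>_. restrict_space borel {0..1})"

definition data_space :: "nat \<Rightarrow> ((nat \<Rightarrow> real) \<times> (nat \<Rightarrow> real)) measure" where
  "data_space d = euclid d \<Otimes>\<^sub>M bin_cube d"

definition l1_norm :: "nat \<Rightarrow> (nat \<Rightarrow> real) \<Rightarrow> real" where
  "l1_norm d v = (\<Sum>j<d. \<bar>v j\<bar>)"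

text \<open>
  A random element (X, Y) of \<open>R^d \<times> {0,1}^d\<close> is represented by its joint law P, a probability
  measure on \<^term>\<open>data_space d\<close>; on that canonical space X is \<^const>\<open>fst\<close> and Y is
  \<^const>\<open>snd\<close>.
\<close>

definition joint_law :: "nat \<Rightarrow> ((nat \<Rightarrow> real) \<times> (nat \<Rightarrow> real)) measure \<Rightarrow> bool" where
  "joint_law d P \<longleftrightarrow> prob_space P \<and> sets P = sets (data_space d)"

definition sigma_X :: "nat \<Rightarrow> ((nat \<Rightarrow> real) \<times> (nat \<Rightarrow> real)) measure
    \<Rightarrow> ((nat \<Rightarrow> real) \<times> (nat \<Rightarrow> real)) measure" where
  "sigma_X d P = vimage_algebra (space P) fst (euclid d)"

definition cond_prob_given :: "'a measure \<Rightarrow> 'a measure \<Rightarrow> 'a set \<Rightarrow> 'a \<Rightarrow> real" where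
  "cond_prob_given M F A = real_cond_exp M F (indicator A)"

definition cond_indep_vars ::
  "'a measure \<Rightarrow> 'a measure \<Rightarrow> ('i \<Rightarrow> 'b measure) \<Rightarrow> ('i \<Rightarrow> 'a \<Rightarrow> 'b) \<Rightarrow> 'i set \<Rightarrow> bool" where
  "cond_indep_vars M F N Y I \<longleftrightarrow>
     (\<forall>i\<in>I. Y i \<in> M \<rightarrow>\<^sub>M N i) \<and>
     (\<forall>J A. J \<subseteq> I \<longrightarrow> finite J \<longrightarrow> J \<noteq> {} \<longrightarrow> (\<forall>j\<in>J. A j \<in> sets (N j)) \<longrightarrow>
        (AE w in M. cond_prob_given M F (\<Inter>j\<in>J. Y j -` A j \<inter> space M) w
                  = (\<Prod>j\<in>J. cond_prob_given M F (Y j -` A j \<inter> space M) w)))"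

definition cond_indep_labels :: "nat \<Rightarrow> ((nat \<Rightarrow> real) \<times> (nat \<Rightarrow> real)) measure \<Rightarrow> bool" where
  "cond_indep_labels d P \<longleftrightarrow>
     cond_indep_vars P (sigma_X d P) (\<lambda>_. count_space {0, 1}) (\<lambda>j z. snd z j) {..<d}"

text \<open>p is a version of \<open>x \<mapsto> (P(Y_j = 1 | X = x))_j\<close>.\<close>

definition label_prob ::
  "nat \<Rightarrow> ((nat \<Rightarrow> real) \<times> (nat \<Rightarrow> real)) measure \<Rightarrow> ((nat \<Rightarrow> real) \<Rightarrow> nat \<Rightarrow> real) \<Rightarrow> bool" where
  "label_prob d P p \<longleftrightarrow>
     p \<in> euclid d \<rightarrow>\<^sub>M unit_cube d \<and>
     (\<forall>j<d. AE z in P. cond_prob_given P (sigma_X d P) {w \<in> space P. snd w j = 1} z = p (fst z) j)"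

definition distinct_probs ::
  "nat \<Rightarrow> ((nat \<Rightarrow> real) \<times> (nat \<Rightarrow> real)) measure \<Rightarrow> ((nat \<Rightarrow> real) \<Rightarrow> nat \<Rightarrow> real) \<Rightarrow> bool" where
  "distinct_probs d P p \<longleftrightarrow> (AE z in P. inj_on (p (fst z)) {..<d})"

definition iou_ratio :: "real \<Rightarrow> nat \<Rightarrow> (nat \<Rightarrow> real) \<Rightarrow> (nat \<Rightarrow> real) \<Rightarrow> real" where
  "iou_ratio \<gamma> d y s =
     ((\<Sum>j<d. y j * s j) + \<gamma>) / (l1_norm d y + l1_norm d s - (\<Sum>j<d. y j * s j) + \<gamma>)"

definition IoU :: "real \<Rightarrow> nat \<Rightarrow> ((nat \<Rightarrow> real) \<times> (nat \<Rightarrow> real)) measure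
    \<Rightarrow> ((nat \<Rightarrow> real) \<Rightarrow> nat \<Rightarrow> real) \<Rightarrow> real" where
  "IoU \<gamma> d P \<delta> = (\<integral>z. iou_ratio \<gamma> d (snd z) (\<delta> (fst z)) \<partial>P)"

definition bayes_rule :: "real \<Rightarrow> nat \<Rightarrow> ((nat \<Rightarrow> real) \<times> (nat \<Rightarrow> real)) measure
    \<Rightarrow> ((nat \<Rightarrow> real) \<Rightarrow> nat \<Rightarrow> real) \<Rightarrow> bool" where
  "bayes_rule \<gamma> d P \<delta> \<longleftrightarrow> is_arg_max (IoU \<gamma> d P) (\<lambda>\<delta>. \<delta> \<in> euclid d \<rightarrow>\<^sub>M bin_cube d) \<delta>"

definition bernoulli_sum_pmf :: "nat set \<Rightarrow> (nat \<Rightarrow> real) \<Rightarrow> nat pmf" where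
  "bernoulli_sum_pmf I q =
     map_pmf (\<lambda>B. \<Sum>j\<in>I. of_bool (B j)) (Pi_pmf I False (\<lambda>j. bernoulli_pmf (q j)))"

text \<open>
  An ordering j_1, ..., j_d is a bijection \<open>\<sigma>\<close> of \<^term>\<open>{..<d}\<close>, so that J_tau is
  \<open>\<sigma> ` {..<\<tau>}\<close>. If tau = gamma = 0 the first factor of the objective vanishes, so the
  objective is 0 in that case.
\<close>

definition rank_objective ::
  "real \<Rightarrow> nat \<Rightarrow> (nat \<Rightarrow> real) \<Rightarrow> (nat \<Rightarrow> nat) \<Rightarrow> nat \<Rightarrow> real" where
  "rank_objective \<gamma> d q \<sigma> \<tau> =
     ((\<Sum>j\<in>\<sigma> ` {..<\<tau>}. q j) + \<gamma>) *
     (\<Sum>l=0..d - \<tau>. 1 / (real \<tau> + real l + \<gamma>) *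
        pmf (bernoulli_sum_pmf ({..<d} - \<sigma> ` {..<\<tau>}) q) l)"

definition descending_order :: "nat \<Rightarrow> (nat \<Rightarrow> real) \<Rightarrow> (nat \<Rightarrow> nat) \<Rightarrow> bool" where
  "descending_order d q \<sigma> \<longleftrightarrow>
     bij_betw \<sigma> {..<d} {..<d} \<and> (\<forall>a b. a \<le> b \<longrightarrow> b < d \<longrightarrow> q (\<sigma> b) \<le> q (\<sigma> a))"

text \<open>
  Any choice among tied orderings and maximizers is admitted, as long as the
  resulting rule is measurable.
\<close>

definition rank_iou_rule :: "real \<Rightarrow> nat \<Rightarrow> ((nat \<Rightarrow> real) \<Rightarrow> nat \<Rightarrow> real)
    \<Rightarrow> ((nat \<Rightarrow> real) \<Rightarrow> nat \<Rightarrow> real) \<Rightarrow> bool" where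
  "rank_iou_rule \<gamma> d q \<delta> \<longleftrightarrow>
     \<delta> \<in> euclid d \<rightarrow>\<^sub>M bin_cube d \<and>
     (\<forall>x\<in>space (euclid d). \<exists>\<sigma> \<tau>.
        descending_order d (q x) \<sigma> \<and>
        is_arg_max (rank_objective \<gamma> d (q x) \<sigma>) (\<lambda>t. t \<le> d) \<tau> \<and>
        (\<forall>j<d. \<delta> x j = (if j \<in> \<sigma> ` {..<\<tau>} then 1 else 0)))"

text \<open>
  For q in [0,1]^d the cross-entropy loss takes values in [0, infinity]: -log 0 is infinity,
  and \<open>0 * \<infinity> = 0\<close> in \<^typ>\<open>ennreal\<close>.
\<close>

definition neg_log :: "real \<Rightarrow> ennreal" where
  "neg_log t = (if t = 0 then \<infinity> else ennreal (- ln t))"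

definition ce_loss :: "nat \<Rightarrow> (nat \<Rightarrow> real) \<Rightarrow> (nat \<Rightarrow> real) \<Rightarrow> ennreal" where
  "ce_loss d y q =
     (\<Sum>j<d. ennreal (y j) * neg_log (q j) + ennreal (1 - y j) * neg_log (1 - q j))"

text \<open>
  The subtrahend below is at most d log 2 when p is the true conditional probability vector,
  so the difference is never \<open>\<infinity> - \<infinity>\<close>.
\<close>

definition ce_excess :: "nat \<Rightarrow> ((nat \<Rightarrow> real) \<times> (nat \<Rightarrow> real)) measure
    \<Rightarrow> ((nat \<Rightarrow> real) \<Rightarrow> nat \<Rightarrow> real) \<Rightarrow> ((nat \<Rightarrow> real) \<Rightarrow> nat \<Rightarrow> real) \<Rightarrow> ereal" where
  "ce_excess d P p q =
     enn2ereal (\<integral>\<^sup>+z. ce_loss d (snd z) (q (fst z)) \<partial>P)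
     - enn2ereal (\<integral>\<^sup>+z. ce_loss d (snd z) (p (fst z)) \<partial>P)"

definition big_O_P :: "'w measure \<Rightarrow> (nat \<Rightarrow> 'w \<Rightarrow> ereal) \<Rightarrow> (nat \<Rightarrow> real) \<Rightarrow> bool" where
  "big_O_P M Z a \<longleftrightarrow>
     (\<forall>e>0. \<exists>C>0. \<forall>\<^sub>F n in sequentially.
        measure M {w \<in> space M. \<bar>Z n w\<bar> > ereal (C * a n)} < e)"

end

theory Submission
  imports Defs
begin

text \<open>
  Conditionally on X = x, the IoU of a fixed segmentation has a mean that is multi-affine in the label
  probabilities with values in [0,1], hence 1-Lipschitz in them for the l1 norm. A swap argument shows that
  the RankIoU rule maximizes this mean over all segmentations when the probabilities are q(x). Passing from
  p(x) to q(x) and back therefore costs at most \<open>2 * \<parallel>q(x) - p(x)\<parallel>\<close>, and C2 = 2 works for every \<open>\<gamma>\<close>.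

  For the rate, the Hellinger bound gives \<open>KL(a, b) \<ge> (a - b)^2 / 2\<close> for Bernoulli laws, so the excess
  cross-entropy dominates half the expected squared l2 distance, and two applications of the Cauchy-Schwarz
  inequality bound the expected l1 distance by \<open>sqrt (2 * d * excess)\<close>.
\<close>

section \<open>Means over independent Bernoulli subsets\<close>

text \<open>The Lipschitz constant does not grow with \<open>d\<close>: the ratio lies in the unit
  interval, so changing one probability moves the mean by at most that change. This is why the l1
  distance appears and one constant serves all dimensions. A label vector enters as the set of
  indices with label 1, which turns conditional means into finite sums over subsets of
  \<open>{..<d}\<close>. A zero denominator can occur only for \<open>\<gamma> = 0\<close> and an
  empty segmentation, and swaps act on nonempty sets. In the cross-entropy part the obstacle is
  infinite values, since an estimate may put probability 0 on a label that occurs. The bounds are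
  therefore additive statements in \<open>ennreal\<close>, and subtraction waits until the entropy
  of \<open>p\<close> is known to be finite.\<close>

definition bern_weight :: "'a set \<Rightarrow> ('a \<Rightarrow> real) \<Rightarrow> 'a set \<Rightarrow> real" where
  "bern_weight I q B = (\<Prod>j\<in>I. if j \<in> B then q j else 1 - q j)"

text \<open>Expectation over independent Bernoulli labels, each outcome coded by its set of
  successes. A finite sum makes sense for arbitrary real \<open>q\<close>, so linearity and the
  recursion below hold without range conditions.\<close>

definition bern_mean :: "'a set \<Rightarrow> ('a \<Rightarrow> real) \<Rightarrow> ('a set \<Rightarrow> real) \<Rightarrow> real" where
  "bern_mean I q f = (\<Sum>B\<in>Pow I. bern_weight I q B * f B)"

lemma bern_mean_empty [simp]: "bern_mean {} q f = f {}"
  by (simp add: bern_mean_def bern_weight_def)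

text \<open>Conditioning on whether \<open>k\<close> is a success: the subsets containing
  \<open>k\<close> are the images of the subsets of \<open>I\<close> under \<open>insert k\<close>.
  The inductions on the index set below run on this recursion.\<close>

lemma bern_mean_insert:
  assumes I: "finite I" "k \<notin> I"
  shows "bern_mean (insert k I) q f
    = q k * bern_mean I q (\<lambda>B. f (insert k B)) + (1 - q k) * bern_mean I q f"
proof -
  have inj: "inj_on (insert k) (Pow I)"
    using I by (auto simp: inj_on_def)
  have w1: "bern_weight (insert k I) q (insert k B) = q k * bern_weight I q B"
    and w0: "bern_weight (insert k I) q B = (1 - q k) * bern_weight I q B" if "B \<in> Pow I" for B
  proof -
    have "k \<notin> B" using I that by blast
    have "(\<Prod>j\<in>I. if j \<in> insert k B then q j else 1 - q j) = (\<Prod>j\<in>I. if j \<in> B then q j else 1 - q j)"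
      using I by (intro prod.cong) auto
    then show "bern_weight (insert k I) q (insert k B) = q k * bern_weight I q B"
      using I by (simp add: bern_weight_def)
    show "bern_weight (insert k I) q B = (1 - q k) * bern_weight I q B"
      using I \<open>k \<notin> B\<close> by (simp add: bern_weight_def)
  qed
  have "bern_mean (insert k I) q f
    = (\<Sum>B\<in>Pow I. bern_weight (insert k I) q B * f B)
      + (\<Sum>B\<in>insert k ` Pow I. bern_weight (insert k I) q B * f B)"
    unfolding bern_mean_def Pow_insert using I by (intro sum.union_disjoint) auto
  also have "\<dots> = (\<Sum>B\<in>Pow I. (1 - q k) * bern_weight I q B * f B)
      + (\<Sum>B\<in>Pow I. q k * bern_weight I q B * f (insert k B))"
    by (simp add: sum.reindex[OF inj] w0 w1)
  finally show ?thesis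
    by (simp add: bern_mean_def sum_distrib_left mult.assoc)
qed

lemma bern_mean_cong:
  assumes "\<And>j. j \<in> I \<Longrightarrow> p j = q j" "\<And>B. B \<subseteq> I \<Longrightarrow> f B = g B"
  shows "bern_mean I p f = bern_mean I q g"
  unfolding bern_mean_def bern_weight_def
  by (intro sum.cong arg_cong2[of _ _ _ _ "(*)"] prod.cong) (auto simp: assms)

lemma bern_mean_mono:
  assumes "\<And>j. j \<in> I \<Longrightarrow> q j \<in> {0..1}" "\<And>B. B \<subseteq> I \<Longrightarrow> f B \<le> g B"
  shows "bern_mean I q f \<le> bern_mean I q g"
  unfolding bern_mean_def bern_weight_def
  using assms by (intro sum_mono mult_left_mono prod_nonneg) auto

lemma bern_mean_add: "bern_mean I q (\<lambda>B. f B + g B) = bern_mean I q f + bern_mean I q g"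
  by (simp add: bern_mean_def distrib_left sum.distrib)

lemma bern_mean_cmult: "bern_mean I q (\<lambda>B. c * f B) = c * bern_mean I q f"
  by (simp add: bern_mean_def sum_distrib_left mult.left_commute)

lemma bern_mean_multc: "bern_mean I q (\<lambda>B. f B * c) = bern_mean I q f * c"
  using bern_mean_cmult[of I q c f] by (simp add: mult.commute)

lemma bern_mean_sum: "bern_mean I q (\<lambda>B. \<Sum>l\<in>L. f l B) = (\<Sum>l\<in>L. bern_mean I q (f l))"
  unfolding bern_mean_def sum_distrib_left by (rule sum.swap)

lemma bern_mean_const [simp]: "finite I \<Longrightarrow> bern_mean I q (\<lambda>_. c) = c"
  by (induction I rule: finite_induct) (simp_all add: bern_mean_insert algebra_simps)

text \<open>Supplies the factor \<open>sum q S\<close> in the score of a segmentation: each index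
  raises the expected number of successes by its own probability.\<close>

lemma bern_mean_card: "finite I \<Longrightarrow> bern_mean I q (\<lambda>B. real (card B)) = sum q I"
proof (induction I rule: finite_induct)
  case (insert k I)
  have "bern_mean I q (\<lambda>B. real (card (insert k B))) = bern_mean I q (\<lambda>B. real (card B) + 1)"
  proof (intro bern_mean_cong refl)
    fix B assume "B \<subseteq> I"
    then have "finite B" "k \<notin> B" using insert.hyps by (auto intro: finite_subset)
    then show "real (card (insert k B)) = real (card B) + 1" by simp
  qed
  with insert show ?case
    by (simp add: bern_mean_insert bern_mean_add algebra_simps)
qed simp

lemma bern_mean_01:
  assumes "finite I" "\<And>j. j \<in> I \<Longrightarrow> q j \<in> {0..1}" "\<And>B. B \<subseteq> I \<Longrightarrow> f B \<in> {0..1}"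
  shows "bern_mean I q f \<in> {0..1}"
  using bern_mean_mono[of I q "\<lambda>_. 0" f] bern_mean_mono[of I q f "\<lambda>_. 1"] assms by simp

text \<open>The mean is multi-affine in the success probabilities.\<close>

lemma bern_mean_lipschitz:
  assumes "finite I" "\<And>j. j \<in> I \<Longrightarrow> p j \<in> {0..1}" "\<And>j. j \<in> I \<Longrightarrow> q j \<in> {0..1}"
    "\<And>B. B \<subseteq> I \<Longrightarrow> f B \<in> {0..1}"
  shows "\<bar>bern_mean I p f - bern_mean I q f\<bar> \<le> (\<Sum>j\<in>I. \<bar>p j - q j\<bar>)"
  using assms
proof (induction I arbitrary: f rule: finite_induct)
  case (insert k I)
  let ?f = "\<lambda>B. f (insert k B)"
  let ?s = "\<Sum>j\<in>I. \<bar>p j - q j\<bar>"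
  have P: "p j \<in> {0..1}" "q j \<in> {0..1}" if "j \<in> I" for j
    using that insert.prems(1,2) by blast+
  have f: "f (insert k B) \<in> {0..1}" "f B \<in> {0..1}" if "B \<subseteq> I" for B
    using that by (blast intro!: insert.prems(3))+
  have IH: "\<bar>bern_mean I p ?f - bern_mean I q ?f\<bar> \<le> ?s"
    by (rule insert.IH[OF P f(1)])
  have IH': "\<bar>bern_mean I p f - bern_mean I q f\<bar> \<le> ?s"
    by (rule insert.IH[OF P f(2)])
  have b: "bern_mean I q ?f \<in> {0..1}" by (rule bern_mean_01[OF insert.hyps(1) P(2) f(1)])
  have b': "bern_mean I q f \<in> {0..1}" by (rule bern_mean_01[OF insert.hyps(1) P(2) f(2)])
  have pk: "p k \<in> {0..1}" using insert.prems by blast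
  \<comment> \<open>Change all other coordinates before \<open>k\<close>. The two recursive
    differences then carry the weights \<open>p k\<close> and \<open>1 - p k\<close>, which add up
    to 1, so their bounds average to \<open>?s\<close> instead of accumulating.\<close>
  have "bern_mean (insert k I) p f - bern_mean (insert k I) q f
     = p k * (bern_mean I p ?f - bern_mean I q ?f) + (1 - p k) * (bern_mean I p f - bern_mean I q f)
       + (p k - q k) * (bern_mean I q ?f - bern_mean I q f)"
    using insert.hyps by (simp add: bern_mean_insert algebra_simps)
  also have "\<bar>\<dots>\<bar> \<le> p k * ?s + (1 - p k) * ?s + \<bar>p k - q k\<bar> * 1"
    unfolding abs_mult
  proof (intro order.trans[OF abs_triangle_ineq] add_mono)
    show "\<bar>p k * (bern_mean I p ?f - bern_mean I q ?f)\<bar> \<le> p k * ?s"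
      using IH pk by (simp add: abs_mult mult_left_mono)
    show "\<bar>(1 - p k) * (bern_mean I p f - bern_mean I q f)\<bar> \<le> (1 - p k) * ?s"
      using IH' pk by (simp add: abs_mult mult_left_mono)
    have "\<bar>bern_mean I q ?f - bern_mean I q f\<bar> \<le> 1" using b b' by auto
    then show "\<bar>(p k - q k) * (bern_mean I q ?f - bern_mean I q f)\<bar> \<le> \<bar>p k - q k\<bar> * 1"
      unfolding abs_mult by (intro mult_left_mono) auto
  qed
  finally show ?case using insert.hyps by (simp add: algebra_simps)
qed simp

text \<open>Independence of disjoint blocks of labels in the form of a Fubini rule: one block is
  averaged while the other is frozen.\<close>

lemma bern_mean_Un:
  assumes "finite S" "finite T" "S \<inter> T = {}"
  shows "bern_mean (S \<union> T) q f = bern_mean S q (\<lambda>A. bern_mean T q (\<lambda>B. f (A \<union> B)))"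
  using assms
  by (induction S arbitrary: f rule: finite_induct) (simp_all add: bern_mean_insert)

lemma pmf_bernoulli_sum:
  assumes I: "finite I" and q: "\<And>j. j \<in> I \<Longrightarrow> q j \<in> {0..1}"
  shows "pmf (bernoulli_sum_pmf I q) l = bern_mean I q (\<lambda>B. of_bool (card B = l))"
proof -
  let ?P = "Pi_pmf I False (\<lambda>j. bernoulli_pmf (q j))"
  let ?g = "\<lambda>B j. j \<in> B"
  let ?h = "\<lambda>b. of_bool ((\<Sum>j\<in>I. of_bool (b j)) = l) :: real"
  \<comment> \<open>The default value \<open>False\<close> outside \<open>I\<close> confines the
    support to membership predicates of subsets of \<open>I\<close>, so the expectation becomes a
    finite sum over \<open>Pow I\<close>.\<close>
  have sub: "set_pmf ?P \<subseteq> ?g ` Pow I"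
  proof
    fix b assume "b \<in> set_pmf ?P"
    then have "b \<in> {b. \<forall>x. x \<notin> I \<longrightarrow> b x = False}" using set_Pi_pmf_subset[OF I] by (rule rev_subsetD)
    then have "{x. b x} \<in> Pow I" by auto
    moreover have "b = ?g {x. b x}" by simp
    ultimately show "b \<in> ?g ` Pow I" by (rule rev_image_eqI)
  qed
  have "pmf (bernoulli_sum_pmf I q) l
      = measure_pmf.expectation ?P (indicator ((\<lambda>b. \<Sum>j\<in>I. of_bool (b j)) -` {l}))"
    by (simp add: bernoulli_sum_pmf_def pmf_map)
  also have "\<dots> = measure_pmf.expectation ?P ?h"
    by (intro Bochner_Integration.integral_cong) (auto simp: indicator_def)
  also have "\<dots> = (\<Sum>b\<in>?g ` Pow I. ?h b * pmf ?P b)"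
    using I sub by (intro integral_measure_pmf_real) auto
  also have "\<dots> = (\<Sum>B\<in>Pow I. ?h (?g B) * pmf ?P (?g B))"
    by (rule sum.reindex_cong[of ?g]) (auto simp: inj_on_def fun_eq_iff)
  also have "\<dots> = bern_mean I q (\<lambda>B. of_bool (card B = l))"
    unfolding bern_mean_def
  proof (intro sum.cong refl)
    fix B assume B: "B \<in> Pow I"
    have "pmf ?P (?g B) = (\<Prod>j\<in>I. pmf (bernoulli_pmf (q j)) (j \<in> B))"
      using I B by (intro pmf_Pi') auto
    also have "\<dots> = bern_weight I q B"
      unfolding bern_weight_def using q by (intro prod.cong) auto
    finally show "?h (?g B) * pmf ?P (?g B) = bern_weight I q B * of_bool (card B = l)"
      using I B by (simp add: Int_absorb1 flip: sum.inter_filter)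
  qed
  finally show ?thesis .
qed

section \<open>The conditional expected IoU of a segmentation\<close>

text \<open>
  The intersection of the label set with \<open>S\<close> and its remainder outside \<open>S\<close> are independent, so
  the conditional mean of the IoU ratio of \<open>S\<close> factors as below.
\<close>

definition set_score :: "real \<Rightarrow> nat \<Rightarrow> (nat \<Rightarrow> real) \<Rightarrow> nat set \<Rightarrow> real" where
  "set_score \<gamma> d q S = (sum q S + \<gamma>) *
     bern_mean ({..<d} - S) q (\<lambda>B. 1 / (real (card S) + real (card B) + \<gamma>))"

text \<open>Grouping the outcomes outside the chosen set by their number \<open>l\<close> of
  successes gives the inner sum of the objective. The cutoff \<open>d - \<tau>\<close> loses
  nothing, as only that many indices remain.\<close>

lemma rank_objective_eq:
  assumes q: "\<And>j. j < d \<Longrightarrow> q j \<in> {0..1}" and S: "\<sigma> ` {..<\<tau>} \<subseteq> {..<d}" "card (\<sigma> ` {..<\<tau>}) = \<tau>"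
  shows "rank_objective \<gamma> d q \<sigma> \<tau> = set_score \<gamma> d q (\<sigma> ` {..<\<tau>})"
proof -
  let ?T = "{..<d} - \<sigma> ` {..<\<tau>}"
  have cT: "card ?T = d - \<tau>" using S by (simp add: card_Diff_subset)
  have pmf: "pmf (bernoulli_sum_pmf ?T q) l = bern_mean ?T q (\<lambda>B. of_bool (card B = l))" for l
    by (rule pmf_bernoulli_sum) (use q in auto)
  have "(\<Sum>l=0..d - \<tau>. 1 / (real \<tau> + real l + \<gamma>) * pmf (bernoulli_sum_pmf ?T q) l)
      = bern_mean ?T q (\<lambda>B. \<Sum>l=0..d - \<tau>. 1 / (real \<tau> + real l + \<gamma>) * of_bool (card B = l))"
    by (simp only: bern_mean_sum bern_mean_cmult) (simp only: pmf)
  also have "\<dots> = bern_mean ?T q (\<lambda>B. 1 / (real \<tau> + real (card B) + \<gamma>))"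
  proof (intro bern_mean_cong refl)
    fix B assume "B \<subseteq> ?T"
    then have "card B \<le> d - \<tau>" using card_mono[of ?T B] cT by simp
    then show "(\<Sum>l=0..d - \<tau>. 1 / (real \<tau> + real l + \<gamma>) * of_bool (card B = l))
        = 1 / (real \<tau> + real (card B) + \<gamma>)"
      by (simp add: of_bool_def if_distrib cong: if_cong)
  qed
  finally show ?thesis using S by (simp add: rank_objective_def set_score_def)
qed

text \<open>The union of \<open>B\<close> and \<open>S\<close> is counted as \<open>S\<close> plus
  \<open>B - S\<close>. The numerator thus sees only the labels inside \<open>S\<close> and the
  denominator only those outside, which is what makes the mean factor.\<close>

lemma iou_ratio_indicator:
  assumes "S \<subseteq> {..<d}" "B \<subseteq> {..<d}"
    and s: "\<And>j. j < d \<Longrightarrow> s j = indicator S j" and y: "\<And>j. j < d \<Longrightarrow> y j = indicator B j"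
  shows "iou_ratio \<gamma> d y s
    = (real (card (B \<inter> S)) + \<gamma>) / (real (card S) + real (card (B - S)) + \<gamma>)"
proof -
  have c: "(\<Sum>j<d. indicator A j) = real (card A)" if "A \<subseteq> {..<d}" for A :: "nat set"
    using that by (simp add: indicator_def sum.If_cases Int_absorb1)
  have f: "finite B" using assms finite_subset by blast
  have "(\<Sum>j<d. y j * s j) = (\<Sum>j<d. indicator (B \<inter> S) j)"
    by (intro sum.cong) (auto simp: s y indicator_def)
  also have "\<dots> = real (card (B \<inter> S))" using assms by (intro c) auto
  finally have 1: "(\<Sum>j<d. y j * s j) = real (card (B \<inter> S))" .
  have 2: "l1_norm d y = real (card B)" "l1_norm d s = real (card S)"
    using assms by (simp_all add: l1_norm_def c)
  have 3: "real (card (B - S)) = real (card B) - real (card (B \<inter> S))"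
    using f by (metis card_Diff_subset_Int card_mono finite_Int inf_le1 of_nat_diff)
  show ?thesis unfolding iou_ratio_def 1 2 3 by (simp add: algebra_simps)
qed

lemma iou_ratio_01:
  assumes "0 \<le> \<gamma>" "S \<subseteq> {..<d}" "B \<subseteq> {..<d}"
    "\<And>j. j < d \<Longrightarrow> s j = indicator S j" "\<And>j. j < d \<Longrightarrow> y j = indicator B j"
  shows "iou_ratio \<gamma> d y s \<in> {0..1}"
proof -
  have "card (B \<inter> S) \<le> card S"
    using assms by (intro card_mono) (auto intro: finite_subset)
  \<comment> \<open>For \<open>\<gamma> = 0\<close> and two empty sets the ratio is 0/0, which HOL
    evaluates to 0, in agreement with the convention for the IoU.\<close>
  then show ?thesis
    using assms(1) by (simp add: iou_ratio_indicator[OF assms(2-5)] divide_le_eq)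
qed

text \<open>At the true probabilities this is the conditional mean of the IoU given the features; at
  the estimated ones it is what the RankIoU rule maximizes. Probabilities and segmentation are
  separate arguments so that the former can change while the latter stays fixed.\<close>

definition iou_mean :: "real \<Rightarrow> nat \<Rightarrow> (nat \<Rightarrow> real) \<Rightarrow> (nat \<Rightarrow> real) \<Rightarrow> real" where
  "iou_mean \<gamma> d p s = bern_mean {..<d} p (\<lambda>B. iou_ratio \<gamma> d (indicator B) s)"

lemma iou_mean_eq:
  assumes S: "S \<subseteq> {..<d}" "\<And>j. j < d \<Longrightarrow> s j = indicator S j"
  shows "iou_mean \<gamma> d p s = set_score \<gamma> d p S"
proof -
  have fin: "finite S" using S finite_subset by blast
  have U: "S \<union> ({..<d} - S) = {..<d}" using S by blast
  let ?r = "\<lambda>B. iou_ratio \<gamma> d (indicator B) s"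
  have "iou_mean \<gamma> d p s = bern_mean S p (\<lambda>A. bern_mean ({..<d} - S) p (\<lambda>B. ?r (A \<union> B)))"
    unfolding iou_mean_def by (subst bern_mean_Un[symmetric]) (use fin U in auto)
  also have "\<dots> = bern_mean S p (\<lambda>A. bern_mean ({..<d} - S) p
      (\<lambda>B. (real (card A) + \<gamma>) * (1 / (real (card S) + real (card B) + \<gamma>))))"
  proof (intro bern_mean_cong refl)
    fix A B assume AB: "A \<subseteq> S" "B \<subseteq> {..<d} - S"
    then have "(A \<union> B) \<inter> S = A" "(A \<union> B) - S = B" "A \<union> B \<subseteq> {..<d}" using S by blast+
    then show "?r (A \<union> B) = (real (card A) + \<gamma>) * (1 / (real (card S) + real (card B) + \<gamma>))"
      using iou_ratio_indicator[OF S(1), of "A \<union> B" s "indicator (A \<union> B)" \<gamma>] S(2) by simp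
  qed
  also have "\<dots> = set_score \<gamma> d p S"
    unfolding bern_mean_cmult bern_mean_multc using fin
    by (simp add: set_score_def bern_mean_add bern_mean_card)
  finally show ?thesis .
qed

lemma iou_mean_lipschitz:
  assumes "0 \<le> \<gamma>" "S \<subseteq> {..<d}" "\<And>j. j < d \<Longrightarrow> s j = indicator S j"
    "\<And>j. j < d \<Longrightarrow> p j \<in> {0..1}" "\<And>j. j < d \<Longrightarrow> q j \<in> {0..1}"
  shows "\<bar>iou_mean \<gamma> d p s - iou_mean \<gamma> d q s\<bar> \<le> l1_norm d (\<lambda>j. q j - p j)"
  unfolding iou_mean_def l1_norm_def abs_minus_commute[of "q _" "p _"]
  using assms by (intro bern_mean_lipschitz iou_ratio_01[where S = S]) auto

text \<open>The swap increases both factors of \<^const>\<open>set_score\<close>.\<close>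

lemma set_score_swap:
  assumes "0 \<le> \<gamma>" and q: "\<And>j. j < d \<Longrightarrow> q j \<in> {0..1}"
    and S: "S \<subseteq> {..<d}" "j \<in> S" "k < d" "k \<notin> S" and le: "q j \<le> q k"
  shows "set_score \<gamma> d q S \<le> set_score \<gamma> d q (insert k (S - {j}))"
proof -
  let ?S' = "insert k (S - {j})"
  let ?R = "{..<d} - S - {k}"
  have fin: "finite S" using S finite_subset by blast
  have jd: "j < d" "j \<noteq> k" using S by auto
  have card: "card ?S' = card S"
    using card_Suc_Diff1[OF fin S(2)] S fin by (subst card_insert_disjoint) auto
  have sum: "sum q ?S' = sum q S - q j + q k"
    using S fin by (subst sum.insert) (auto simp: sum_diff1)
  \<comment> \<open>Nonemptiness keeps every denominator positive even for
    \<open>\<gamma> = 0\<close>; with the value \<open>1 / 0 = 0\<close> the monotonicity in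
    \<open>anti\<close> could fail.\<close>
  have c0: "card S > 0" using S fin by (auto simp: card_gt_0_iff)
  let ?f = "\<lambda>B. 1 / (real (card S) + real (card B) + \<gamma>)"
  have T: "{..<d} - S = insert k ?R" "{..<d} - ?S' = insert j ?R" using S by auto
  have anti: "bern_mean ?R q (\<lambda>B. ?f (insert i B)) \<le> bern_mean ?R q ?f" for i
  proof (intro bern_mean_mono)
    show "?f (insert i B) \<le> ?f B" if "B \<subseteq> ?R" for B
    proof -
      have "finite B" using that by (auto intro: finite_subset)
      then have "card B \<le> card (insert i B)" by (intro card_mono) auto
      then show ?thesis using c0 assms(1) by (intro divide_left_mono) auto
    qed
  qed (use q in auto)
  have ins: "bern_mean ?R q (\<lambda>B. ?f (insert j B)) = bern_mean ?R q (\<lambda>B. ?f (insert k B))"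
  proof (intro bern_mean_cong refl)
    fix B assume "B \<subseteq> ?R"
    then have "finite B" "j \<notin> B" "k \<notin> B" using S by (auto intro: finite_subset)
    then show "?f (insert j B) = ?f (insert k B)" by simp
  qed
  \<comment> \<open>The two complements share \<open>?R\<close> and differ by one index.
    \<open>?u\<close> and \<open>?v\<close> are the means when that index is a failure or a success,
    so lowering the weight of the smaller mean \<open>?v\<close> from \<open>q k\<close> to
    \<open>q j\<close> raises the result.\<close>
  let ?u = "bern_mean ?R q ?f" and ?v = "bern_mean ?R q (\<lambda>B. ?f (insert k B))"
  have m: "bern_mean ({..<d} - S) q ?f = q k * ?v + (1 - q k) * ?u"
    by (subst T(1), rule bern_mean_insert) auto
  have m': "bern_mean ({..<d} - ?S') q ?f = q j * ?v + (1 - q j) * ?u"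
    by (subst T(2), subst ins[symmetric], rule bern_mean_insert) (use S in auto)
  have "(q k - q j) * ?v \<le> (q k - q j) * ?u"
    using le anti by (intro mult_left_mono) auto
  then have mm: "bern_mean ({..<d} - S) q ?f \<le> bern_mean ({..<d} - ?S') q ?f"
    unfolding m m' by (simp add: algebra_simps)
  have nn: "0 \<le> bern_mean ({..<d} - S) q ?f"
    using bern_mean_mono[of "{..<d} - S" q "\<lambda>_. 0" ?f] q assms(1) by simp
  have "0 \<le> sum q S" using q S by (intro sum_nonneg) (auto simp: subset_iff)
  then have "(sum q S + \<gamma>) * bern_mean ({..<d} - S) q ?f
      \<le> (sum q S - q j + q k + \<gamma>) * bern_mean ({..<d} - ?S') q ?f"
    using le assms(1) by (intro mult_mono mm nn) linarith+
  then show ?thesis unfolding set_score_def card sum .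
qed

text \<open>Each swap trades an element outside the top set of the same size for one inside it. The
  cardinality, and hence the target, stays fixed, while the number of misplaced elements
  drops.\<close>

lemma set_score_le_rank:
  assumes g: "0 \<le> \<gamma>" and q: "\<And>j. j < d \<Longrightarrow> q j \<in> {0..1}" and ord: "descending_order d q \<sigma>"
    and S: "S \<subseteq> {..<d}"
  shows "set_score \<gamma> d q S \<le> set_score \<gamma> d q (\<sigma> ` {..<card S})"
  using S
proof (induction "card (S - \<sigma> ` {..<card S})" arbitrary: S rule: less_induct)
  case less
  let ?T = "\<sigma> ` {..<card S}"
  have bij: "bij_betw \<sigma> {..<d} {..<d}" and mono: "\<And>a b. a \<le> b \<Longrightarrow> b < d \<Longrightarrow> q (\<sigma> b) \<le> q (\<sigma> a)"
    using ord by (auto simp: descending_order_def)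
  have fin: "finite S" and cd: "card S \<le> d"
    using less.prems finite_subset card_mono[of "{..<d}" S] by auto
  have T: "?T \<subseteq> {..<d}" "card ?T = card S"
    using bij cd by (auto simp: bij_betw_def intro!: card_image[THEN trans] inj_on_subset[of \<sigma> "{..<d}"])
  show ?case
  proof (cases "S \<subseteq> ?T")
    case True
    then have "S = ?T" using T by (intro card_subset_eq) auto
    then show ?thesis by simp
  next
    case False
    then obtain j where j: "j \<in> S" "j \<notin> ?T" by blast
    have "\<not> ?T \<subseteq> S" using j T fin card_subset_eq[of S ?T] by auto
    then obtain k where k: "k \<in> ?T" "k \<notin> S" by blast
    obtain a where a: "a < card S" "k = \<sigma> a" using k by blast
    obtain b where b: "b < d" "j = \<sigma> b" using j(1) less.prems bij unfolding bij_betw_def by (metis imageE lessThan_iff subsetD)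
    \<comment> \<open>\<open>j\<close> lies outside the top set, so its rank \<open>b\<close> is at
      least \<open>card S\<close>, beyond the rank \<open>a\<close> of \<open>k\<close>.\<close>
    have "\<not> b < card S" using b j by blast
    then have le: "q j \<le> q k" using a b mono[of a b] by simp
    let ?S' = "insert k (S - {j})"
    have card: "card ?S' = card S"
      using card_Suc_Diff1[OF fin j(1)] k fin by (subst card_insert_disjoint) auto
    have "?S' - ?T = (S - ?T) - {j}" using k by blast
    then have "card (?S' - \<sigma> ` {..<card ?S'}) < card (S - ?T)"
      unfolding card using fin j by (metis DiffI card_Diff1_less finite_Diff)
    moreover have "k < d" using k T by blast
    ultimately have "set_score \<gamma> d q ?S' \<le> set_score \<gamma> d q ?T"
      using less.hyps[of ?S'] less.prems card by auto
    moreover have "set_score \<gamma> d q S \<le> set_score \<gamma> d q ?S'"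
      using g q less.prems j k \<open>k < d\<close> le by (intro set_score_swap) auto
    ultimately show ?thesis by simp
  qed
qed

lemma rank_rule_maximizes_iou_mean:
  assumes g: "0 \<le> \<gamma>" and q: "\<And>j. j < d \<Longrightarrow> q x j \<in> {0..1}"
    and rule: "rank_iou_rule \<gamma> d q \<delta>" and x: "x \<in> space (euclid d)"
    and S: "S \<subseteq> {..<d}" "\<And>j. j < d \<Longrightarrow> s j = indicator S j"
  shows "iou_mean \<gamma> d (q x) s \<le> iou_mean \<gamma> d (q x) (\<delta> x)"
proof -
  obtain \<sigma> \<tau> where ord: "descending_order d (q x) \<sigma>"
    and max: "is_arg_max (rank_objective \<gamma> d (q x) \<sigma>) (\<lambda>t. t \<le> d) \<tau>"
    and \<delta>: "\<And>j. j < d \<Longrightarrow> \<delta> x j = (if j \<in> \<sigma> ` {..<\<tau>} then 1 else 0)"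
    using rule x unfolding rank_iou_rule_def by blast
  have bij: "bij_betw \<sigma> {..<d} {..<d}" using ord by (simp add: descending_order_def)
  have T: "\<sigma> ` {..<t} \<subseteq> {..<d}" "card (\<sigma> ` {..<t}) = t" if "t \<le> d" for t
    using bij that
    by (auto simp: bij_betw_def intro!: card_image[THEN trans] inj_on_subset[of \<sigma> "{..<d}"])
  have \<tau>: "\<tau> \<le> d" using max by (simp add: is_arg_max_def)
  have c: "card S \<le> d" using S card_mono[of "{..<d}" S] by simp
  have "iou_mean \<gamma> d (q x) s = set_score \<gamma> d (q x) S" by (rule iou_mean_eq[OF S])
  also have "\<dots> \<le> set_score \<gamma> d (q x) (\<sigma> ` {..<card S})"
    by (rule set_score_le_rank[OF g q ord S(1)])
  also have "\<dots> = rank_objective \<gamma> d (q x) \<sigma> (card S)"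
    by (rule rank_objective_eq[symmetric, OF q T[OF c]])
  also have "\<dots> \<le> rank_objective \<gamma> d (q x) \<sigma> \<tau>"
    using max c by (auto simp: is_arg_max_linorder)
  also have "\<dots> = set_score \<gamma> d (q x) (\<sigma> ` {..<\<tau>})" by (rule rank_objective_eq[OF q T[OF \<tau>]])
  also have "\<dots> = iou_mean \<gamma> d (q x) (\<delta> x)"
    by (rule iou_mean_eq[symmetric, OF T(1)[OF \<tau>]]) (simp add: \<delta> indicator_def)
  finally show ?thesis .
qed

section \<open>Binary vectors as sets, and measurability of coordinates and losses\<close>

lemma iou_ratio_cong:
  assumes "\<And>j. j < d \<Longrightarrow> y j = y' j"
  shows "iou_ratio \<gamma> d y s = iou_ratio \<gamma> d y' s"
proof -
  have "(\<Sum>j<d. y j * s j) = (\<Sum>j<d. y' j * s j)" "l1_norm d y = l1_norm d y'"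
    using assms by (auto simp: l1_norm_def)
  then show ?thesis by (simp add: iou_ratio_def)
qed

lemma bin_cube_coord:
  assumes "v \<in> space (bin_cube d)" "j < d"
  shows "v j = indicator {i. i < d \<and> v i = 1} j"
  using assms by (auto simp: bin_cube_def space_PiM PiE_iff indicator_def)

lemma bin_cube_cases: "v \<in> space (bin_cube d) \<Longrightarrow> j < d \<Longrightarrow> v j \<in> {0, 1}"
  by (auto simp: bin_cube_def space_PiM PiE_iff)

lemma unit_cube_coord: "v \<in> space (unit_cube d) \<Longrightarrow> j < d \<Longrightarrow> v j \<in> {0..1}"
  by (auto simp: unit_cube_def space_PiM PiE_iff space_restrict_space)

lemma measurable_bin_coord:
  assumes "f \<in> N \<rightarrow>\<^sub>M bin_cube d" "j < d"
  shows "(\<lambda>x. f x j) \<in> N \<rightarrow>\<^sub>M count_space {0, 1}" "(\<lambda>x. f x j) \<in> borel_measurable N"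
proof -
  show *: "(\<lambda>x. f x j) \<in> N \<rightarrow>\<^sub>M count_space {0, 1}"
    using assms(1) unfolding bin_cube_def
    by (rule measurable_compose[OF _ measurable_component_singleton]) (use assms in auto)
  show "(\<lambda>x. f x j) \<in> borel_measurable N"
    by (rule measurable_compose[OF *]) simp
qed

lemma measurable_unit_coord:
  assumes "f \<in> N \<rightarrow>\<^sub>M unit_cube d" "j < d"
  shows "(\<lambda>x. f x j) \<in> borel_measurable N"
proof -
  have "(\<lambda>x. f x j) \<in> N \<rightarrow>\<^sub>M restrict_space borel {0..1}"
    using assms(1) unfolding unit_cube_def
    by (rule measurable_compose[OF _ measurable_component_singleton]) (use assms in auto)
  then show ?thesis by (simp add: measurable_restrict_space2_iff)
qed

lemma measurable_iou_ratio:
  assumes "f \<in> N \<rightarrow>\<^sub>M bin_cube d"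
  shows "(\<lambda>x. iou_ratio \<gamma> d y (f x)) \<in> borel_measurable N"
  unfolding iou_ratio_def l1_norm_def
  using measurable_bin_coord(2)[OF assms] by measurable

lemma iou_ratio_bin_cube_01:
  assumes "0 \<le> \<gamma>" "B \<subseteq> {..<d}" "s \<in> space (bin_cube d)"
  shows "iou_ratio \<gamma> d (indicator B) s \<in> {0..1}"
  by (rule iou_ratio_01[OF assms(1) _ assms(2) bin_cube_coord[OF assms(3)]]) auto

lemma measurable_neg_log [measurable]: "neg_log \<in> borel_measurable borel"
  unfolding neg_log_def by measurable

lemma measurable_ce_loss:
  assumes "\<And>j. j < d \<Longrightarrow> (\<lambda>x. f x j) \<in> borel_measurable N"
    and "\<And>j. j < d \<Longrightarrow> (\<lambda>x. g x j) \<in> borel_measurable N"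
  shows "(\<lambda>x. ce_loss d (f x) (g x)) \<in> borel_measurable N"
  unfolding ce_loss_def using assms by measurable

text \<open>The factor \<open>h\<close> will be \<open>neg_log\<close> of an estimated probability
  and may be infinite, so the product need not be integrable and the pull-out rule for
  \<open>real_cond_exp\<close> is out of reach. Identifying \<open>g\<close> with
  \<open>nn_cond_exp\<close>, through integrals over sets of \<open>F\<close>, gives access to the
  rule for nonnegative extended functions.\<close>

lemma (in sigma_finite_subalgebra) nn_integral_mult_cond_exp:
  assumes f: "integrable M f" "\<And>x. 0 \<le> f x" and g: "integrable M g" "\<And>x. x \<in> space M \<Longrightarrow> 0 \<le> g x"
    and gF: "g \<in> borel_measurable F" and eq: "AE x in M. real_cond_exp M F f x = g x"
    and h: "h \<in> borel_measurable F"
  shows "(\<integral>\<^sup>+x. h x * ennreal (f x) \<partial>M) = (\<integral>\<^sup>+x. h x * ennreal (g x) \<partial>M)"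
proof -
  have [measurable]: "f \<in> borel_measurable M" "g \<in> borel_measurable F" using f gF by auto
  have "AE x in M. ennreal (g x) = nn_cond_exp M F (\<lambda>x. ennreal (f x)) x"
  proof (rule nn_cond_exp_charact)
    fix A assume A: "A \<in> sets F"
    then have AM: "A \<in> sets M" using subalg by (auto simp: subalgebra_def)
    have int: "integrable M (\<lambda>x. indicator A x * f x)" "integrable M (\<lambda>x. indicator A x * g x)"
      using integrable_mult_indicator[OF AM f(1)] integrable_mult_indicator[OF AM g(1)] by auto
    have gM: "g \<in> borel_measurable M" using g(1) by auto
    have "(\<integral>\<^sup>+x\<in>A. ennreal (f x) \<partial>M) = (\<integral>\<^sup>+x. ennreal (indicator A x * f x) \<partial>M)"
      by (intro nn_integral_cong) (auto simp: indicator_def)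
    also have "\<dots> = ennreal (\<integral>x. indicator A x * f x \<partial>M)"
      using int f by (intro nn_integral_eq_integral) auto
    also have "(\<integral>x. indicator A x * f x \<partial>M) = (\<integral>x. indicator A x * real_cond_exp M F f x \<partial>M)"
      using real_cond_exp_intA[OF f(1) A] by (simp add: set_lebesgue_integral_def)
    also have "\<dots> = (\<integral>x. indicator A x * g x \<partial>M)"
      using eq AM gM by (intro integral_cong_AE) auto
    also have "ennreal \<dots> = (\<integral>\<^sup>+x. ennreal (indicator A x * g x) \<partial>M)"
      using int g by (intro nn_integral_eq_integral[symmetric] AE_I2) auto
    also have "\<dots> = (\<integral>\<^sup>+x\<in>A. ennreal (g x) \<partial>M)"
      by (intro nn_integral_cong) (auto simp: indicator_def)
    finally show "(\<integral>\<^sup>+x\<in>A. ennreal (f x) \<partial>M) = (\<integral>\<^sup>+x\<in>A. ennreal (g x) \<partial>M)" .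
  qed auto
  then have "(\<integral>\<^sup>+x. h x * ennreal (g x) \<partial>M)
      = (\<integral>\<^sup>+x. h x * nn_cond_exp M F (\<lambda>x. ennreal (f x)) x \<partial>M)"
    by (intro nn_integral_cong_AE) auto
  also have "\<dots> = (\<integral>\<^sup>+x. h x * ennreal (f x) \<partial>M)"
    by (rule nn_cond_exp_intg[OF h]) auto
  finally show ?thesis ..
qed

section \<open>Conditioning on the features\<close>

locale label_model =
  fixes d :: nat and P :: "((nat \<Rightarrow> real) \<times> (nat \<Rightarrow> real)) measure"
    and p :: "(nat \<Rightarrow> real) \<Rightarrow> nat \<Rightarrow> real"
  assumes law: "joint_law d P" and lab: "label_prob d P p"
begin

abbreviation F where "F \<equiv> sigma_X d P"

sublocale prob_space P
  using law by (simp add: joint_law_def)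

lemma sets_P: "sets P = sets (euclid d \<Otimes>\<^sub>M bin_cube d)"
  using law by (simp add: joint_law_def data_space_def)

lemma space_P: "space P = space (euclid d) \<times> space (bin_cube d)"
  using sets_eq_imp_space_eq[OF sets_P] by (simp add: space_pair_measure)

lemma fst_measurable: "fst \<in> P \<rightarrow>\<^sub>M euclid d" and snd_measurable: "snd \<in> P \<rightarrow>\<^sub>M bin_cube d"
  using sets_P by (simp_all cong: measurable_cong_sets)

lemma fst_measurable_F: "fst \<in> F \<rightarrow>\<^sub>M euclid d"
  unfolding sigma_X_def by (rule measurable_vimage_algebra1) (auto simp: space_P)

sublocale finite_measure_subalgebra P F
proof
  have "sets F \<subseteq> sets P"
    unfolding sigma_X_def
    by (rule sets_vimage_algebra2[THEN eq_refl, THEN order.trans])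
      (use measurable_sets[OF fst_measurable] in \<open>auto simp: space_P\<close>)
  then show "subalgebra P F"
    by (simp add: subalgebra_def sigma_X_def)
qed

lemma p_measurable: "p \<in> euclid d \<rightarrow>\<^sub>M unit_cube d"
  using lab by (simp add: label_prob_def)

lemma p_01: "z \<in> space P \<Longrightarrow> j < d \<Longrightarrow> p (fst z) j \<in> {0..1}"
  using measurable_space[OF p_measurable] by (intro unit_cube_coord) (auto simp: space_P)

lemma label_cases: "z \<in> space P \<Longrightarrow> j < d \<Longrightarrow> snd z j \<in> {0, 1}"
  by (rule bin_cube_cases) (auto simp: space_P)

lemma unit_coord_fst:
  assumes "u \<in> euclid d \<rightarrow>\<^sub>M unit_cube d" "j < d"
  shows "(\<lambda>z. u (fst z) j) \<in> borel_measurable F" "(\<lambda>z. u (fst z) j) \<in> borel_measurable P"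
  using measurable_unit_coord[OF measurable_compose[OF fst_measurable_F assms(1)] assms(2)]
    measurable_unit_coord[OF measurable_compose[OF fst_measurable assms(1)] assms(2)] by auto

lemma label_sets: "j < d \<Longrightarrow> (\<lambda>z. snd z j) -` {b} \<inter> space P \<in> sets P"
  using measurable_sets[OF measurable_bin_coord(2)[OF snd_measurable], of j "{b}"] by simp

text \<open>A label takes only the values 0 and 1, so the indicator of label 0 is 1 minus that of
  label 1, and linearity of conditional expectation carries the first claim to the second.\<close>

lemma cond_label:
  assumes j: "j < d"
  shows "AE z in P. cond_prob_given P F ((\<lambda>z. snd z j) -` {1} \<inter> space P) z = p (fst z) j"
    and "AE z in P. cond_prob_given P F ((\<lambda>z. snd z j) -` {0} \<inter> space P) z = 1 - p (fst z) j"
proof -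
  let ?E = "\<lambda>b. (\<lambda>z. snd z j) -` {b :: real} \<inter> space P"
  have E1: "?E 1 = {w \<in> space P. snd w j = 1}" by auto
  have a1: "AE z in P. real_cond_exp P F (indicator (?E 1)) z = p (fst z) j"
    using lab j unfolding E1 label_prob_def cond_prob_given_def by auto
  then show "AE z in P. cond_prob_given P F (?E 1) z = p (fst z) j"
    by (simp add: cond_prob_given_def)
  have int: "integrable P (indicator (?E 1) :: _ \<Rightarrow> real)"
    using label_sets[OF j] by (intro integrable_real_indicator) (auto simp: less_top[symmetric])
  have "AE z in P. real_cond_exp P F (indicator (?E 0)) z = real_cond_exp P F (\<lambda>z. 1 - indicator (?E 1) z) z"
  proof (rule real_cond_exp_cong)
    show "AE z in P. indicator (?E 0) z = 1 - (indicator (?E 1) z :: real)"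
      using label_cases[OF _ j] by (intro AE_I2) (auto simp: indicator_def)
  qed (use label_sets[OF j] in auto)
  moreover have "AE z in P. real_cond_exp P F (\<lambda>z. 1 - indicator (?E 1) z) z
      = real_cond_exp P F (\<lambda>_. 1) z - real_cond_exp P F (indicator (?E 1)) z"
    using int by (intro real_cond_exp_diff) auto
  moreover have "AE z in P. real_cond_exp P F (\<lambda>_. 1) z = 1"
    by (intro real_cond_exp_F_meas) auto
  ultimately show "AE z in P. cond_prob_given P F (?E 0) z = 1 - p (fst z) j"
    unfolding cond_prob_given_def using a1 by eventually_elim simp
qed

lemma cond_label_vector:
  assumes ind: "cond_indep_labels d P" and B: "B \<subseteq> {..<d}"
  shows "AE z in P. real_cond_exp P F (indicator {z \<in> space P. \<forall>j<d. snd z j = indicator B j}) z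
    = bern_weight {..<d} (p (fst z)) B"
proof (cases "d = 0")
  case True
  \<comment> \<open>Conditional independence speaks of nonempty index sets. For \<open>d = 0\<close>
    the event is the whole space and the weight an empty product, so both sides are 1.\<close>
  have "AE z in P. real_cond_exp P F (indicator (space P)) z = indicator (space P) z"
    using sets.top[of F] by (intro real_cond_exp_F_meas borel_measurable_indicator)
      (auto simp: sigma_X_def emeasure_space_1)
  moreover have "AE z in P. z \<in> space P" by simp
  ultimately show ?thesis
    by eventually_elim (simp add: True bern_weight_def)
next
  case False
  let ?Y = "\<lambda>j z. snd z j"
  let ?A = "\<lambda>j. {indicator B j :: real}"
  have E: "{z \<in> space P. \<forall>j<d. snd z j = indicator B j} = (\<Inter>j\<in>{..<d}. ?Y j -` ?A j \<inter> space P)"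
    using False by auto
  have *: "AE z in P. cond_prob_given P F (\<Inter>j\<in>{..<d}. ?Y j -` ?A j \<inter> space P) z
      = (\<Prod>j\<in>{..<d}. cond_prob_given P F (?Y j -` ?A j \<inter> space P) z)"
    using False
    by (intro conjunct2[OF ind[unfolded cond_indep_labels_def cond_indep_vars_def], rule_format])
      (auto simp: indicator_def)
  have "AE z in P. \<forall>j\<in>{..<d}. cond_prob_given P F (?Y j -` ?A j \<inter> space P) z
      = (if j \<in> B then p (fst z) j else 1 - p (fst z) j)"
    using cond_label by (intro AE_finite_allI) (auto simp: indicator_def)
  with * show ?thesis
    unfolding E bern_weight_def cond_prob_given_def by eventually_elim simp
qed

lemma measurable_bern_weight: "(\<lambda>z. bern_weight {..<d} (p (fst z)) B) \<in> borel_measurable P"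
proof -
  have "(\<lambda>z. if j \<in> B then p (fst z) j else 1 - p (fst z) j) \<in> borel_measurable P" if "j < d" for j
    using unit_coord_fst(2)[OF p_measurable that] by auto
  then show ?thesis unfolding bern_weight_def by (intro borel_measurable_prod) auto
qed

lemma rule_measurable:
  assumes "\<delta> \<in> euclid d \<rightarrow>\<^sub>M bin_cube d"
  shows "(\<lambda>z. \<delta> (fst z)) \<in> F \<rightarrow>\<^sub>M bin_cube d" "(\<lambda>z. \<delta> (fst z)) \<in> P \<rightarrow>\<^sub>M bin_cube d"
    "z \<in> space P \<Longrightarrow> \<delta> (fst z) \<in> space (bin_cube d)"
  using measurable_compose[OF fst_measurable_F assms] measurable_compose[OF fst_measurable assms]
    measurable_space[OF assms] by (auto simp: space_P)

lemma integrable_iou_mean: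
  assumes g: "0 \<le> \<gamma>" and \<delta>: "\<delta> \<in> euclid d \<rightarrow>\<^sub>M bin_cube d"
  shows "integrable P (\<lambda>z. iou_mean \<gamma> d (p (fst z)) (\<delta> (fst z)))"
proof (rule integrable_const_bound[where B = 1])
  have "iou_mean \<gamma> d (p (fst z)) (\<delta> (fst z)) \<in> {0..1}" if "z \<in> space P" for z
    unfolding iou_mean_def using g p_01[OF that] rule_measurable(3)[OF \<delta> that]
    by (intro bern_mean_01 iou_ratio_bin_cube_01) auto
  then show "AE z in P. norm (iou_mean \<gamma> d (p (fst z)) (\<delta> (fst z))) \<le> 1"
    by (intro AE_I2) fastforce
  show "(\<lambda>z. iou_mean \<gamma> d (p (fst z)) (\<delta> (fst z))) \<in> borel_measurable P"
    unfolding iou_mean_def bern_mean_def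
    using measurable_bern_weight measurable_iou_ratio[OF rule_measurable(2)[OF \<delta>]]
    by (intro borel_measurable_sum borel_measurable_times) auto
qed

text \<open>Splitting over the finitely many label patterns writes the integrand as a sum of
  products of a function of the features and the indicator of a label event. The first factor is
  bounded and \<open>F\<close>-measurable, so under the integral the indicator may be replaced by
  its conditional expectation, a product of label probabilities.\<close>

lemma IoU_eq:
  assumes g: "0 \<le> \<gamma>" and ind: "cond_indep_labels d P" and \<delta>: "\<delta> \<in> euclid d \<rightarrow>\<^sub>M bin_cube d"
  shows "IoU \<gamma> d P \<delta> = (\<integral>z. iou_mean \<gamma> d (p (fst z)) (\<delta> (fst z)) \<partial>P)"
proof -
  let ?r = "\<lambda>B z. iou_ratio \<gamma> d (indicator B) (\<delta> (fst z))"
  let ?E = "\<lambda>B. {z \<in> space P. \<forall>j<d. snd z j = indicator B j}"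
  have E: "?E B \<in> sets P" for B
  proof -
    have "?E B = space P \<inter> (\<Inter>j\<in>{..<d}. (\<lambda>z. snd z j) -` {indicator B j} \<inter> space P)
      \<or> d = 0" by auto
    moreover have "(\<Inter>j\<in>{..<d}. (\<lambda>z. snd z j) -` {indicator B j} \<inter> space P) \<in> sets P" if "d \<noteq> 0"
      using that label_sets by (intro sets.finite_INT) auto
    ultimately show ?thesis by (cases "d = 0") auto
  qed
  have rb: "?r B z \<in> {0..1}" if "B \<subseteq> {..<d}" "z \<in> space P" for B z
    using g that rule_measurable(3)[OF \<delta>] by (intro iou_ratio_bin_cube_01) auto
  have rF: "?r B \<in> borel_measurable F" for B
    by (rule measurable_iou_ratio[OF rule_measurable(1)[OF \<delta>]])
  have rP: "?r B \<in> borel_measurable P" for B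
    by (rule measurable_iou_ratio[OF rule_measurable(2)[OF \<delta>]])
  have int: "integrable P (\<lambda>z. ?r B z * indicator (?E B) z)" if "B \<subseteq> {..<d}" for B
  proof (rule integrable_const_bound[where B = 1])
    show "AE z in P. norm (?r B z * indicator (?E B) z) \<le> 1"
      using rb[OF that] by (intro AE_I2) (auto simp: indicator_def)
  qed (use rP E in measurable)
  have eq: "AE z in P. ?r B z * real_cond_exp P F (indicator (?E B)) z
      = ?r B z * bern_weight {..<d} (p (fst z)) B" if "B \<subseteq> {..<d}" for B
    using cond_label_vector[OF ind that] by eventually_elim simp
  have "IoU \<gamma> d P \<delta> = (\<integral>z. (\<Sum>B\<in>Pow {..<d}. ?r B z * indicator (?E B) z) \<partial>P)"
    unfolding IoU_def
  proof (rule Bochner_Integration.integral_cong[OF refl])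
    fix z assume z: "z \<in> space P"
    \<comment> \<open>The observed label set. \<open>z\<close> lies in exactly one of the pattern
      events, so only the term for \<open>C\<close> survives in the sum.\<close>
    define C where "C = {i. i < d \<and> snd z i = 1}"
    have C: "C \<subseteq> {..<d}" by (auto simp: C_def)
    have y: "snd z j = indicator C j" if "j < d" for j
      unfolding C_def using z that by (intro bin_cube_coord) (auto simp: space_P)
    have ind: "indicator (?E B) z = (if B = C then 1 else 0 :: real)" if "B \<in> Pow {..<d}" for B
    proof -
      have "z \<in> ?E B \<longleftrightarrow> (\<forall>j<d. (indicator C j :: real) = indicator B j)"
        using z y by simp
      also have "\<dots> \<longleftrightarrow> B = C"
      proof
        assume h: "\<forall>j<d. (indicator C j :: real) = indicator B j"
        have "j \<in> B \<longleftrightarrow> j \<in> C" for j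
          using h[rule_format, of j] that C by (cases "j < d") (auto simp: indicator_def split: if_splits)
        then show "B = C" by blast
      qed simp
      finally show ?thesis by (simp add: indicator_def)
    qed
    have "(\<Sum>B\<in>Pow {..<d}. ?r B z * indicator (?E B) z)
        = (\<Sum>B\<in>Pow {..<d}. if B = C then ?r B z else 0)"
    proof (intro sum.cong refl)
      fix B assume B: "B \<in> Pow {..<d}"
      show "?r B z * indicator (?E B) z = (if B = C then ?r B z else 0)"
        unfolding ind[OF B] by simp
    qed
    also have "\<dots> = ?r C z" using C by (subst sum.delta) auto
    also have "\<dots> = iou_ratio \<gamma> d (snd z) (\<delta> (fst z))"
      by (rule iou_ratio_cong) (rule y[symmetric])
    finally show "iou_ratio \<gamma> d (snd z) (\<delta> (fst z))
        = (\<Sum>B\<in>Pow {..<d}. ?r B z * indicator (?E B) z)" ..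
  qed
  also have "\<dots> = (\<Sum>B\<in>Pow {..<d}. \<integral>z. ?r B z * indicator (?E B) z \<partial>P)"
    using int by (intro Bochner_Integration.integral_sum) auto
  also have "\<dots> = (\<Sum>B\<in>Pow {..<d}. \<integral>z. ?r B z * bern_weight {..<d} (p (fst z)) B \<partial>P)"
  proof (intro sum.cong refl)
    fix B assume "B \<in> Pow {..<d}"
    then have B: "B \<subseteq> {..<d}" by simp
    have "(\<integral>z. ?r B z * indicator (?E B) z \<partial>P)
        = (\<integral>z. ?r B z * real_cond_exp P F (indicator (?E B)) z \<partial>P)"
      by (rule real_cond_exp_intg(2)[OF int[OF B] rF borel_measurable_indicator[OF E], symmetric])
    also have "\<dots> = (\<integral>z. ?r B z * bern_weight {..<d} (p (fst z)) B \<partial>P)"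
      by (rule integral_cong_AE[OF borel_measurable_times[OF rP borel_measurable_cond_exp2]
            borel_measurable_times[OF rP measurable_bern_weight] eq[OF B]])
    finally show "(\<integral>z. ?r B z * indicator (?E B) z \<partial>P)
        = (\<integral>z. ?r B z * bern_weight {..<d} (p (fst z)) B \<partial>P)" .
  qed
  also have "\<dots> = (\<integral>z. (\<Sum>B\<in>Pow {..<d}. ?r B z * bern_weight {..<d} (p (fst z)) B) \<partial>P)"
  proof (intro Bochner_Integration.integral_sum[symmetric])
    fix B assume "B \<in> Pow {..<d}"
    then have B: "B \<subseteq> {..<d}" by simp
    have "integrable P (\<lambda>z. ?r B z * real_cond_exp P F (indicator (?E B)) z)"
      by (rule real_cond_exp_intg(1)[OF int[OF B] rF borel_measurable_indicator[OF E]])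
    then show "integrable P (\<lambda>z. ?r B z * bern_weight {..<d} (p (fst z)) B)"
      by (rule integrable_cong_AE_imp[OF _ borel_measurable_times[OF rP measurable_bern_weight]])
        (use eq[OF B] in \<open>eventually_elim, simp\<close>)
  qed
  also have "\<dots> = (\<integral>z. iou_mean \<gamma> d (p (fst z)) (\<delta> (fst z)) \<partial>P)"
    by (simp add: iou_mean_def bern_mean_def mult.commute)
  finally show ?thesis .
qed

lemma measurable_l1_diff:
  assumes "q \<in> euclid d \<rightarrow>\<^sub>M unit_cube d"
  shows "(\<lambda>z. l1_norm d (\<lambda>j. q (fst z) j - p (fst z) j)) \<in> borel_measurable P"
  unfolding l1_norm_def
  using unit_coord_fst(2)[OF assms] unit_coord_fst(2)[OF p_measurable] by measurable

lemma unit_coord_diff: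
  assumes q: "q \<in> euclid d \<rightarrow>\<^sub>M unit_cube d" and z: "z \<in> space P" "j < d"
  shows "q (fst z) j \<in> {0..1}" "\<bar>q (fst z) j - p (fst z) j\<bar> \<le> 1"
proof -
  show "q (fst z) j \<in> {0..1}"
    using measurable_space[OF q] z by (intro unit_cube_coord) (auto simp: space_P)
  with p_01[OF z] show "\<bar>q (fst z) j - p (fst z) j\<bar> \<le> 1" by auto
qed

lemma l1_diff_le:
  assumes "q \<in> euclid d \<rightarrow>\<^sub>M unit_cube d" "z \<in> space P"
  shows "l1_norm d (\<lambda>j. q (fst z) j - p (fst z) j) \<le> d"
  using sum_mono[of "{..<d}" "\<lambda>j. \<bar>q (fst z) j - p (fst z) j\<bar>" "\<lambda>_. 1"] unit_coord_diff[OF assms]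
  by (simp add: l1_norm_def)

lemma integrable_l1_diff:
  assumes "q \<in> euclid d \<rightarrow>\<^sub>M unit_cube d"
  shows "integrable P (\<lambda>z. l1_norm d (\<lambda>j. q (fst z) j - p (fst z) j))"
  using l1_diff_le[OF assms] measurable_l1_diff[OF assms]
  by (intro integrable_const_bound[where B = d] AE_I2) (auto simp: l1_norm_def sum_nonneg)

text \<open>Optimality for the probabilities \<open>q x\<close> is used pointwise, before
  integration, so the bound holds against any measurable competitor and in particular against a
  Bayes rule.\<close>

lemma IoU_regret_le:
  assumes g: "0 \<le> \<gamma>" and ind: "cond_indep_labels d P" and q: "q \<in> euclid d \<rightarrow>\<^sub>M unit_cube d"
    and rank: "rank_iou_rule \<gamma> d q \<delta>" and \<delta>': "\<delta>' \<in> euclid d \<rightarrow>\<^sub>M bin_cube d"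
  shows "IoU \<gamma> d P \<delta>' - IoU \<gamma> d P \<delta> \<le> 2 * (\<integral>z. l1_norm d (\<lambda>j. q (fst z) j - p (fst z) j) \<partial>P)"
proof -
  let ?l = "\<lambda>z. l1_norm d (\<lambda>j. q (fst z) j - p (fst z) j)"
  let ?m = "\<lambda>\<delta> z. iou_mean \<gamma> d (p (fst z)) (\<delta> (fst z))"
  have \<delta>: "\<delta> \<in> euclid d \<rightarrow>\<^sub>M bin_cube d" using rank by (simp add: rank_iou_rule_def)
  have "?m \<delta>' z \<le> ?m \<delta> z + 2 * ?l z" if z: "z \<in> space P" for z
  proof -
    have x: "fst z \<in> space (euclid d)" using z by (auto simp: space_P)
    have lip: "\<bar>?m \<rho> z - iou_mean \<gamma> d (q (fst z)) (\<rho> (fst z))\<bar> \<le> ?l z"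
      if "\<rho> \<in> euclid d \<rightarrow>\<^sub>M bin_cube d" for \<rho>
      by (rule iou_mean_lipschitz[OF g _ bin_cube_coord[OF rule_measurable(3)[OF that z]]])
        (use p_01[OF z] unit_coord_diff[OF q z] in auto)
    have "iou_mean \<gamma> d (q (fst z)) (\<delta>' (fst z)) \<le> iou_mean \<gamma> d (q (fst z)) (\<delta> (fst z))"
      by (rule rank_rule_maximizes_iou_mean[OF g _ rank x _
            bin_cube_coord[OF rule_measurable(3)[OF \<delta>' z]]])
        (use unit_coord_diff[OF q z] in auto)
    then show ?thesis using lip[OF \<delta>] lip[OF \<delta>'] by linarith
  qed
  then have "(\<integral>z. ?m \<delta>' z \<partial>P) \<le> (\<integral>z. ?m \<delta> z + 2 * ?l z \<partial>P)"
    using integrable_iou_mean[OF g] \<delta> \<delta>' integrable_l1_diff[OF q] by (intro integral_mono) auto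
  also have "\<dots> = (\<integral>z. ?m \<delta> z \<partial>P) + 2 * (\<integral>z. ?l z \<partial>P)"
    using integrable_iou_mean[OF g \<delta>] integrable_l1_diff[OF q] by simp
  finally show ?thesis using IoU_eq[OF g ind] \<delta> \<delta>' by simp
qed

end

section \<open>Excess cross-entropy\<close>

text \<open>Apply \<open>ln t \<le> t - 1\<close> at \<open>t = sqrt (b / a)\<close>: summed over the two outcomes, this bounds the
  Kullback-Leibler divergence below by the squared Hellinger distance.\<close>

lemma real_cross_entropy_term:
  fixes a b :: real
  assumes "0 < b" "0 \<le> a"
  shows "- a * ln b \<ge> - a * ln a + 2 * a - 2 * sqrt a * sqrt b"
proof (cases "a = 0")
  case False
  then have a: "a > 0" using assms by simp
  define r where "r = sqrt b / sqrt a"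
  have "ln r \<le> r - 1"
    using a assms by (intro ln_le_minus_one) (simp add: r_def)
  moreover have "ln r = (ln b - ln a) / 2"
    using a assms by (simp add: r_def ln_div ln_sqrt)
  ultimately have "ln b - ln a \<le> 2 * (r - 1)" by (simp add: field_simps)
  then have "a * (ln b - ln a) \<le> a * (2 * (r - 1))"
    using a by (intro mult_left_mono) auto
  also have "\<dots> = 2 * sqrt a * sqrt b - 2 * a"
    unfolding r_def using a by (simp add: field_simps)
  finally show ?thesis by (simp add: algebra_simps)
qed simp

text \<open>\<open>a - b\<close> is the product of the difference and the sum of the square roots.
  The sum is at most 2, and squaring gives the 4.\<close>

lemma diff_square_le_hellinger:
  fixes a b :: real
  assumes "a \<in> {0..1}" "b \<in> {0..1}"
  shows "(a - b)\<^sup>2 / 4 \<le> a + b - 2 * sqrt a * sqrt b"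
proof -
  have s: "sqrt a \<in> {0..1}" "sqrt b \<in> {0..1}" using assms by auto
  then have "sqrt a + sqrt b \<le> 2" "0 \<le> sqrt a + sqrt b" unfolding atLeastAtMost_iff by linarith+
  then have "(sqrt a + sqrt b)\<^sup>2 \<le> 2\<^sup>2" by (intro power_mono)
  then have "(sqrt a - sqrt b)\<^sup>2 * (sqrt a + sqrt b)\<^sup>2 \<le> (sqrt a - sqrt b)\<^sup>2 * 4"
    by (intro mult_left_mono) auto
  moreover have "(sqrt a - sqrt b)\<^sup>2 * (sqrt a + sqrt b)\<^sup>2 = (a - b)\<^sup>2"
    using assms by (simp add: algebra_simps flip: power_mult_distrib)
  moreover have "(sqrt a - sqrt b)\<^sup>2 = a + b - 2 * sqrt a * sqrt b"
    using assms by (simp add: power2_diff)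
  ultimately show ?thesis by simp
qed

text \<open>Each outcome has a Hellinger term of at least \<open>(a - b)\<^sup>2 / 4\<close>, and
  the two add up to the half. The bound is a sum and not a difference because the right side may be
  infinite and subtraction in \<open>ennreal\<close> truncates.\<close>

lemma bernoulli_pinsker:
  fixes a b :: real
  assumes a: "a \<in> {0..1}" and b: "b \<in> {0..1}"
  shows "ennreal a * neg_log a + ennreal (1 - a) * neg_log (1 - a) + ennreal ((a - b)\<^sup>2 / 2)
    \<le> ennreal a * neg_log b + ennreal (1 - a) * neg_log (1 - b)"
proof -
  \<comment> \<open>Zero times infinity is 0 in \<open>ennreal\<close>, which matches
    \<open>0 * ln 0 = 0\<close> in \<open>real\<close>. The two readings of a loss term thus agree
    unless an outcome of predicted probability 0 has positive mass.\<close>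
  have mult_log: "ennreal x * neg_log y = ennreal (- x * ln y)" if "x \<in> {0..1}" "y \<in> {0..1}" "y = 0 \<longrightarrow> x = 0" for x y
    using that by (cases "y = 0") (auto simp: neg_log_def simp flip: ennreal_mult)
  have nn: "0 \<le> - x * ln y" if "x \<in> {0..1}" "y \<in> {0..1}" for x y :: real
    using that by (cases "y = 0") (auto simp: mult_nonneg_nonpos)
  consider "b = 0" "a > 0" | "b = 1" "a < 1" | "b = 0" "a = 0" | "b = 1" "a = 1" | "0 < b" "b < 1"
    using a b by fastforce
  then show ?thesis
  proof cases
    case 1
    then show ?thesis by (simp add: neg_log_def ennreal_mult_top)
  next
    case 2
    then show ?thesis by (simp add: neg_log_def ennreal_mult_top)
  next
    case 5
    have "(a - b)\<^sup>2 / 4 \<le> a + b - 2 * sqrt a * sqrt b"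
      by (rule diff_square_le_hellinger[OF a b])
    moreover have "(a - b)\<^sup>2 / 4 \<le> (1 - a) + (1 - b) - 2 * sqrt (1 - a) * sqrt (1 - b)"
      using diff_square_le_hellinger[of "1 - a" "1 - b"] a b by (simp add: power2_commute)
    \<comment> \<open>\<open>2 * a + 2 * (1 - a)\<close> equals
      \<open>a + b + (1 - a) + (1 - b)\<close>, so the bounds for the two logarithmic terms add up
      to the two Hellinger terms.\<close>
    ultimately have "- a * ln a + - (1 - a) * ln (1 - a) + (a - b)\<^sup>2 / 2
        \<le> - a * ln b + - (1 - a) * ln (1 - b)"
      using real_cross_entropy_term[of b a] real_cross_entropy_term[of "1 - b" "1 - a"] a b 5
      by simp
    then have "ennreal (- a * ln a + - (1 - a) * ln (1 - a) + (a - b)\<^sup>2 / 2)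
        \<le> ennreal (- a * ln b + - (1 - a) * ln (1 - b))"
      by (rule ennreal_leI)
    moreover have "ennreal (- a * ln b + - (1 - a) * ln (1 - b))
        = ennreal a * neg_log b + ennreal (1 - a) * neg_log (1 - b)"
      using a b 5 nn[of a b] nn[of "1 - a" "1 - b"] by (subst (1 2) mult_log) (auto simp flip: ennreal_plus)
    moreover have "ennreal (- a * ln a + - (1 - a) * ln (1 - a) + (a - b)\<^sup>2 / 2)
        = ennreal a * neg_log a + ennreal (1 - a) * neg_log (1 - a) + ennreal ((a - b)\<^sup>2 / 2)"
      using a nn[of a a] nn[of "1 - a" "1 - a"] by (subst (1 2) mult_log) (auto simp flip: ennreal_plus)
    ultimately show ?thesis by simp
  qed (simp_all add: neg_log_def)
qed

lemma ce_loss_ge: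
  assumes "\<And>j. j < d \<Longrightarrow> p j \<in> {0..1}" "\<And>j. j < d \<Longrightarrow> q j \<in> {0..1}"
  shows "ce_loss d p p + ennreal ((\<Sum>j<d. (p j - q j)\<^sup>2) / 2) \<le> ce_loss d p q"
proof -
  have "ennreal ((\<Sum>j<d. (p j - q j)\<^sup>2) / 2) = (\<Sum>j<d. ennreal ((p j - q j)\<^sup>2 / 2))"
    by (subst sum_ennreal) (simp_all add: sum_divide_distrib)
  then show ?thesis
    unfolding ce_loss_def using assms
    by (simp only: flip: sum.distrib) (intro sum_mono bernoulli_pinsker, auto)
qed

lemma mult_neg_log_le_one:
  assumes "a \<in> {0..1}"
  shows "ennreal a * neg_log a \<le> 1"
proof (cases "a = 0")
  case False
  then have a: "0 < a" "a \<le> 1" using assms by auto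
  have "- ln a \<le> 1 / a - 1"
    using ln_le_minus_one[of "1 / a"] a by (simp add: ln_div)
  then have "a * (- ln a) \<le> a * (1 / a - 1)" using a by (intro mult_left_mono) auto
  also have "\<dots> \<le> 1" using a by (simp add: field_simps)
  finally show ?thesis using a by (simp add: neg_log_def flip: ennreal_mult)
qed simp

text \<open>A crude substitute for \<open>d * ln 2\<close>. Only finiteness matters: it allows the
  entropy of \<open>p\<close> to be subtracted in the excess.\<close>

lemma ce_loss_self_le:
  assumes "\<And>j. j < d \<Longrightarrow> p j \<in> {0..1}"
  shows "ce_loss d p p \<le> ennreal (2 * d)"
proof -
  have "ennreal (p j) * neg_log (p j) + ennreal (1 - p j) * neg_log (1 - p j) \<le> ennreal 2"
    if "j < d" for j
    using add_mono[OF mult_neg_log_le_one[of "p j"] mult_neg_log_le_one[of "1 - p j"]] assms[OF that]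
    by simp
  then have "ce_loss d p p \<le> (\<Sum>j<d. ennreal 2)"
    unfolding ce_loss_def by (intro sum_mono) auto
  also have "\<dots> = ennreal (2 * d)"
    by (subst sum_ennreal) (simp_all add: mult.commute)
  finally show ?thesis .
qed

text \<open>Nonnegativity of the variance; this is the Cauchy-Schwarz step on the probability
  space.\<close>

lemma (in prob_space) integral_square_le:
  fixes f :: "'a \<Rightarrow> real"
  assumes "integrable M f" "integrable M (\<lambda>x. (f x)\<^sup>2)"
  shows "(\<integral>x. f x \<partial>M)\<^sup>2 \<le> (\<integral>x. (f x)\<^sup>2 \<partial>M)"
  using variance_eq[OF assms] variance_positive[of f] by simp

section \<open>From excess cross-entropy to the expected l1 distance\<close>

context label_model
begin

lemma nn_integral_label:
  assumes j: "j < d" and h: "h \<in> borel_measurable F"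
  shows "(\<integral>\<^sup>+z. h z * ennreal (snd z j) \<partial>P) = (\<integral>\<^sup>+z. h z * ennreal (p (fst z) j) \<partial>P)"
    and "(\<integral>\<^sup>+z. h z * ennreal (1 - snd z j) \<partial>P) = (\<integral>\<^sup>+z. h z * ennreal (1 - p (fst z) j) \<partial>P)"
proof -
  let ?E = "\<lambda>b. (\<lambda>z. snd z j) -` {b :: real} \<inter> space P"
  have int: "integrable P (indicator (?E b) :: _ \<Rightarrow> real)" for b
    using label_sets[OF j] by (intro integrable_real_indicator) (auto simp: less_top[symmetric])
  have pint: "integrable P (\<lambda>z. p (fst z) j)"
    using p_01[OF _ j] unit_coord_fst(2)[OF p_measurable j]
    by (intro integrable_const_bound[where B = 1] AE_I2) auto
  have pF: "(\<lambda>z. p (fst z) j) \<in> borel_measurable F" "(\<lambda>z. 1 - p (fst z) j) \<in> borel_measurable F"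
    using unit_coord_fst(1)[OF p_measurable j] by auto
  have "(\<integral>\<^sup>+z. h z * ennreal (indicator (?E 1) z) \<partial>P) = (\<integral>\<^sup>+z. h z * ennreal (p (fst z) j) \<partial>P)"
    using p_01[OF _ j] cond_label(1)[OF j] unfolding cond_prob_given_def
    by (intro nn_integral_mult_cond_exp int pint pF h) auto
  moreover have "(\<integral>\<^sup>+z. h z * ennreal (snd z j) \<partial>P) = (\<integral>\<^sup>+z. h z * ennreal (indicator (?E 1) z) \<partial>P)"
  proof (intro nn_integral_cong)
    fix z assume "z \<in> space P"
    with label_cases[OF this j] show "h z * ennreal (snd z j) = h z * ennreal (indicator (?E 1) z)"
      by (auto simp: indicator_def)
  qed
  ultimately show "(\<integral>\<^sup>+z. h z * ennreal (snd z j) \<partial>P) = (\<integral>\<^sup>+z. h z * ennreal (p (fst z) j) \<partial>P)"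
    by simp
  have "(\<integral>\<^sup>+z. h z * ennreal (indicator (?E 0) z) \<partial>P) = (\<integral>\<^sup>+z. h z * ennreal (1 - p (fst z) j) \<partial>P)"
    using p_01[OF _ j] cond_label(2)[OF j] pint unfolding cond_prob_given_def
    by (intro nn_integral_mult_cond_exp int pF h) auto
  moreover have "(\<integral>\<^sup>+z. h z * ennreal (1 - snd z j) \<partial>P) = (\<integral>\<^sup>+z. h z * ennreal (indicator (?E 0) z) \<partial>P)"
  proof (intro nn_integral_cong)
    fix z assume "z \<in> space P"
    with label_cases[OF this j] show "h z * ennreal (1 - snd z j) = h z * ennreal (indicator (?E 0) z)"
      by (auto simp: indicator_def)
  qed
  ultimately show "(\<integral>\<^sup>+z. h z * ennreal (1 - snd z j) \<partial>P) = (\<integral>\<^sup>+z. h z * ennreal (1 - p (fst z) j) \<partial>P)"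
    by simp
qed

text \<open>The cross-entropy is affine in the labels with coefficients that depend on the features
  alone, so each label may be replaced by its conditional probability under the integral.\<close>

lemma nn_integral_ce_loss:
  assumes q: "q \<in> euclid d \<rightarrow>\<^sub>M unit_cube d"
  shows "(\<integral>\<^sup>+z. ce_loss d (snd z) (q (fst z)) \<partial>P) = (\<integral>\<^sup>+z. ce_loss d (p (fst z)) (q (fst z)) \<partial>P)"
proof -
  \<comment> \<open>A general \<open>y\<close> lets one expansion serve both sides, with the labels
    on the left and \<open>p\<close> on the right.\<close>
  have eq: "(\<integral>\<^sup>+z. ce_loss d (y z) (q (fst z)) \<partial>P)
      = (\<Sum>j<d. (\<integral>\<^sup>+z. neg_log (q (fst z) j) * ennreal (y z j) \<partial>P)
          + (\<integral>\<^sup>+z. neg_log (1 - q (fst z) j) * ennreal (1 - y z j) \<partial>P))"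
    if y: "\<And>j. j < d \<Longrightarrow> (\<lambda>z. y z j) \<in> borel_measurable P" for y
  proof -
    have m: "(\<lambda>z. neg_log (q (fst z) j) * ennreal (y z j)) \<in> borel_measurable P"
      "(\<lambda>z. neg_log (1 - q (fst z) j) * ennreal (1 - y z j)) \<in> borel_measurable P" if "j < d" for j
      using y[OF that] unit_coord_fst(2)[OF q that] by measurable
    have "(\<integral>\<^sup>+z. ce_loss d (y z) (q (fst z)) \<partial>P)
      = (\<integral>\<^sup>+z. (\<Sum>j<d. neg_log (q (fst z) j) * ennreal (y z j)
          + neg_log (1 - q (fst z) j) * ennreal (1 - y z j)) \<partial>P)"
      by (simp add: ce_loss_def mult.commute)
    also have "\<dots> = (\<Sum>j<d. \<integral>\<^sup>+z. neg_log (q (fst z) j) * ennreal (y z j)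
          + neg_log (1 - q (fst z) j) * ennreal (1 - y z j) \<partial>P)"
      using m by (intro nn_integral_sum borel_measurable_add) auto
    also have "\<dots> = (\<Sum>j<d. (\<integral>\<^sup>+z. neg_log (q (fst z) j) * ennreal (y z j) \<partial>P)
          + (\<integral>\<^sup>+z. neg_log (1 - q (fst z) j) * ennreal (1 - y z j) \<partial>P))"
      using m by (intro sum.cong refl nn_integral_add) auto
    finally show ?thesis .
  qed
  have F: "(\<lambda>z. neg_log (q (fst z) j)) \<in> borel_measurable F"
    "(\<lambda>z. neg_log (1 - q (fst z) j)) \<in> borel_measurable F" if "j < d" for j
    using unit_coord_fst(1)[OF q that] by measurable
  show ?thesis
    by (subst (1 2) eq)
      (auto intro!: sum.cong arg_cong2[of _ _ _ _ "(+)"] nn_integral_label F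
        measurable_bin_coord(2)[OF snd_measurable] unit_coord_fst(2)[OF p_measurable])
qed

lemma integrable_square_dist:
  assumes q: "q \<in> euclid d \<rightarrow>\<^sub>M unit_cube d"
  shows "integrable P (\<lambda>z. \<Sum>j<d. (p (fst z) j - q (fst z) j)\<^sup>2)"
proof (rule integrable_const_bound[where B = d])
  show "(\<lambda>z. \<Sum>j<d. (p (fst z) j - q (fst z) j)\<^sup>2) \<in> borel_measurable P"
    using unit_coord_fst(2)[OF p_measurable] unit_coord_fst(2)[OF q] by measurable
  have "(\<Sum>j<d. (p (fst z) j - q (fst z) j)\<^sup>2) \<le> d" if z: "z \<in> space P" for z
  proof -
    have "(p (fst z) j - q (fst z) j)\<^sup>2 \<le> 1" if "j < d" for j
      using unit_coord_diff(2)[OF q z that] by (simp add: abs_square_le_1 abs_minus_commute)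
    then have "(\<Sum>j<d. (p (fst z) j - q (fst z) j)\<^sup>2) \<le> (\<Sum>j<d. 1)" by (intro sum_mono) auto
    then show ?thesis by simp
  qed
  then show "AE z in P. norm (\<Sum>j<d. (p (fst z) j - q (fst z) j)\<^sup>2) \<le> d"
    by (intro AE_I2) (simp add: sum_nonneg)
qed

lemma ce_excess_ge:
  assumes q: "q \<in> euclid d \<rightarrow>\<^sub>M unit_cube d"
  shows "ereal (\<integral>z. (\<Sum>j<d. (p (fst z) j - q (fst z) j)\<^sup>2) / 2 \<partial>P) \<le> ce_excess d P p q"
proof -
  let ?s = "\<lambda>z. (\<Sum>j<d. (p (fst z) j - q (fst z) j)\<^sup>2) / 2"
  let ?c = "\<lambda>u. \<integral>\<^sup>+z. ce_loss d (p (fst z)) (u (fst z)) \<partial>P"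
  have pm: "(\<lambda>z. p (fst z) j) \<in> borel_measurable P" if "j < d" for j
    by (rule unit_coord_fst(2)[OF p_measurable that])
  have sint: "integrable P ?s" using integrable_square_dist[OF q] by simp
  then have sm: "?s \<in> borel_measurable P" by (rule borel_measurable_integrable)
  have s: "0 \<le> ?s z" for z by (simp add: sum_nonneg)
  have "?c p + ennreal (\<integral>z. ?s z \<partial>P) = ?c p + (\<integral>\<^sup>+z. ennreal (?s z) \<partial>P)"
    by (subst nn_integral_eq_integral[OF sint]) (use s in auto)
  also have "\<dots> = (\<integral>\<^sup>+z. ce_loss d (p (fst z)) (p (fst z)) + ennreal (?s z) \<partial>P)"
    using sm measurable_ce_loss[OF pm pm] by (intro nn_integral_add[symmetric]) auto
  also have "\<dots> \<le> ?c q"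
    using p_01 unit_coord_diff(1)[OF q] by (intro nn_integral_mono ce_loss_ge) auto
  finally have le: "?c p + ennreal (\<integral>z. ?s z \<partial>P) \<le> ?c q" .
  \<comment> \<open>Finiteness of the entropy turns the additive bound \<open>le\<close> into one
    for the \<open>ereal\<close> difference. The cross-entropy of \<open>q\<close> may still be
    infinite, which the closing case split covers.\<close>
  have "?c p \<le> (\<integral>\<^sup>+z. ennreal (2 * d) \<partial>P)"
    using p_01 by (intro nn_integral_mono ce_loss_self_le) auto
  also have "\<dots> < \<infinity>" by (simp add: emeasure_space_1 ennreal_mult_less_top)
  finally obtain c where c: "?c p = ennreal c" "0 \<le> c" by (cases "?c p") auto
  have k: "0 \<le> (\<integral>z. ?s z \<partial>P)" using s by (rule Bochner_Integration.integral_nonneg)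
  have "enn2ereal (ennreal (c + (\<integral>z. ?s z \<partial>P))) \<le> enn2ereal (?c q)"
    using le c k unfolding less_eq_ennreal.rep_eq[symmetric] by simp
  then have "ereal (c + (\<integral>z. ?s z \<partial>P)) \<le> enn2ereal (?c q)"
    unfolding enn2ereal_ennreal[OF add_nonneg_nonneg[OF c(2) k]] .
  then show ?thesis
    unfolding ce_excess_def nn_integral_ce_loss[OF q] nn_integral_ce_loss[OF p_measurable] c(1)
    using c(2) by (cases "enn2ereal (?c q)") (auto simp: enn2ereal_ennreal)
qed

lemma integral_l1_diff_le:
  fixes x :: real
  assumes q: "q \<in> euclid d \<rightarrow>\<^sub>M unit_cube d" and x: "ce_excess d P p q \<le> ereal x"
  shows "(\<integral>z. l1_norm d (\<lambda>j. q (fst z) j - p (fst z) j) \<partial>P) \<le> sqrt (2 * d * x)"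
proof -
  let ?l = "\<lambda>z. l1_norm d (\<lambda>j. q (fst z) j - p (fst z) j)"
  let ?s = "\<lambda>z. (\<Sum>j<d. (p (fst z) j - q (fst z) j)\<^sup>2) / 2"
  have lint: "integrable P ?l" by (rule integrable_l1_diff[OF q])
  have l0: "0 \<le> ?l z" for z by (simp add: l1_norm_def sum_nonneg)
  have l2int: "integrable P (\<lambda>z. (?l z)\<^sup>2)"
  proof (rule integrable_const_bound[where B = "(real d)\<^sup>2"])
    show "AE z in P. norm ((?l z)\<^sup>2) \<le> (real d)\<^sup>2"
      using l1_diff_le[OF q] l0 by (intro AE_I2) (auto intro: power_mono)
  qed (use measurable_l1_diff[OF q] in measurable)
  \<comment> \<open>Cauchy-Schwarz against the constant vector 1 gives the factor \<open>d\<close>;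
    the 2 cancels the half in \<open>?s\<close>.\<close>
  have sq: "(?l z)\<^sup>2 \<le> 2 * d * ?s z" for z
    using Cauchy_Schwarz_ineq_sum[of "\<lambda>_. 1" "\<lambda>j. \<bar>q (fst z) j - p (fst z) j\<bar>" "{..<d}"]
    by (simp add: l1_norm_def power2_commute)
  have sint: "integrable P ?s" using integrable_square_dist[OF q] by simp
  have "(\<integral>z. ?l z \<partial>P)\<^sup>2 \<le> (\<integral>z. (?l z)\<^sup>2 \<partial>P)"
    by (rule integral_square_le[OF lint l2int])
  also have "\<dots> \<le> (\<integral>z. 2 * d * ?s z \<partial>P)"
    by (rule integral_mono[OF l2int integrable_mult_right[OF sint] sq])
  also have "\<dots> = 2 * d * (\<integral>z. ?s z \<partial>P)" by (rule integral_mult_right_zero)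
  also have "\<dots> \<le> 2 * d * x"
    using order.trans[OF ce_excess_ge[OF q] x] by (intro mult_left_mono) auto
  finally show ?thesis by (rule real_le_rsqrt)
qed

end

section \<open>Dependence on the training sample and stochastic order\<close>

lemma measurable_ce_excess:
  assumes sf: "sigma_finite_measure P" and sets: "sets P = sets (euclid d \<Otimes>\<^sub>M bin_cube d)"
    and q: "(\<lambda>(w, x). q w x) \<in> M \<Otimes>\<^sub>M euclid d \<rightarrow>\<^sub>M unit_cube d"
  shows "(\<lambda>w. ce_excess d P p (q w)) \<in> borel_measurable M"
proof -
  interpret sigma_finite_measure P by fact
  have f: "fst \<in> P \<rightarrow>\<^sub>M euclid d" and s: "snd \<in> P \<rightarrow>\<^sub>M bin_cube d"
    using sets by (simp_all cong: measurable_cong_sets)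
  have "(\<lambda>(w, z). (w, fst z)) \<in> M \<Otimes>\<^sub>M P \<rightarrow>\<^sub>M M \<Otimes>\<^sub>M euclid d"
    using f by measurable
  from measurable_compose[OF this q]
  have u: "(\<lambda>(w, z). q w (fst z)) \<in> M \<Otimes>\<^sub>M P \<rightarrow>\<^sub>M unit_cube d" by (simp add: case_prod_unfold)
  have y: "(\<lambda>(w, z). snd z) \<in> M \<Otimes>\<^sub>M P \<rightarrow>\<^sub>M bin_cube d"
    using s by measurable
  have "(\<lambda>x. ce_loss d ((\<lambda>(w, z). snd z) x) ((\<lambda>(w, z). q w (fst z)) x)) \<in> borel_measurable (M \<Otimes>\<^sub>M P)"
    using measurable_bin_coord(2)[OF y] measurable_unit_coord[OF u]
    by (intro measurable_ce_loss)
  \<comment> \<open>Joint measurability in \<open>w\<close> and \<open>z\<close> is essential here: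
    by Tonelli the integral over \<open>z\<close> is then measurable in \<open>w\<close>.\<close>
  then have "(\<lambda>w. \<integral>\<^sup>+z. ce_loss d (snd z) (q w (fst z)) \<partial>P) \<in> borel_measurable M"
    by (intro borel_measurable_nn_integral) (simp add: case_prod_unfold)
  then show ?thesis unfolding ce_excess_def by measurable
qed

text \<open>
  Measurability of \<open>Z n\<close> matters: a non-measurable set has measure \<open>0\<close>, so without it the hypothesis on
  \<open>Z\<close> could hold vacuously.
\<close>

lemma big_O_P_transfer:
  assumes M: "prob_space M" and Z: "big_O_P M Z a" and Zm: "\<And>n. Z n \<in> borel_measurable M"
    and imp: "\<And>C n w. C > 0 \<Longrightarrow> w \<in> space M \<Longrightarrow> \<bar>Z n w\<bar> \<le> ereal (C * a n) \<Longrightarrow> \<bar>W n w\<bar> \<le> ereal (f C * b n)"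
    and f: "\<And>C. C > 0 \<Longrightarrow> f C > 0"
  shows "big_O_P M W b"
  unfolding big_O_P_def
proof (intro allI impI)
  interpret prob_space M by fact
  fix e :: real assume "e > 0"
  then obtain C where C: "C > 0"
    and ev: "\<forall>\<^sub>F n in sequentially. measure M {w \<in> space M. \<bar>Z n w\<bar> > ereal (C * a n)} < e"
    using Z unfolding big_O_P_def by blast
  have "measure M {w \<in> space M. \<bar>W n w\<bar> > ereal (f C * b n)}
      \<le> measure M {w \<in> space M. \<bar>Z n w\<bar> > ereal (C * a n)}" for n
  proof (rule finite_measure_mono)
    show "{w \<in> space M. \<bar>W n w\<bar> > ereal (f C * b n)} \<subseteq> {w \<in> space M. \<bar>Z n w\<bar> > ereal (C * a n)}"
      using imp[OF C] by (auto simp: not_le[symmetric])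
    show "{w \<in> space M. \<bar>Z n w\<bar> > ereal (C * a n)} \<in> sets M"
      using Zm[of n] by measurable
  qed
  then have "\<forall>\<^sub>F n in sequentially. measure M {w \<in> space M. \<bar>W n w\<bar> > ereal (f C * b n)} < e"
    using ev by (auto elim!: eventually_mono intro: le_less_trans)
  then show "\<exists>C>0. \<forall>\<^sub>F n in sequentially. measure M {w \<in> space M. \<bar>W n w\<bar> > ereal (C * b n)} < e"
    using f[OF C] by blast
qed

theorem theorem15:
  fixes \<gamma> :: real
  assumes "0 \<le> \<gamma>"
  shows
    "(\<exists>C2>0. \<forall>(d::nat) P p q \<delta>' \<delta>.
        joint_law d P \<longrightarrow> cond_indep_labels d P \<longrightarrow>
        label_prob d P p \<longrightarrow> distinct_probs d P p \<longrightarrow>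
        q \<in> euclid d \<rightarrow>\<^sub>M unit_cube d \<longrightarrow>
        rank_iou_rule \<gamma> d q \<delta> \<longrightarrow>
        bayes_rule \<gamma> d P \<delta>' \<longrightarrow>
        IoU \<gamma> d P \<delta>' - IoU \<gamma> d P \<delta>
          \<le> C2 * (\<integral>z. l1_norm d (\<lambda>j. q (fst z) j - p (fst z) j) \<partial>P))
     \<and>
     (\<forall>(d::nat) P p \<delta>' (M::'w measure)
        (T :: nat \<Rightarrow> 'w \<Rightarrow> nat \<Rightarrow> (nat \<Rightarrow> real) \<times> (nat \<Rightarrow> real))
        (q :: nat \<Rightarrow> (nat \<Rightarrow> (nat \<Rightarrow> real) \<times> (nat \<Rightarrow> real)) \<Rightarrow> (nat \<Rightarrow> real) \<Rightarrow> nat \<Rightarrow> real)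
        \<delta> (\<epsilon> :: nat \<Rightarrow> real).
        joint_law d P \<longrightarrow> cond_indep_labels d P \<longrightarrow>
        label_prob d P p \<longrightarrow> distinct_probs d P p \<longrightarrow>
        bayes_rule \<gamma> d P \<delta>' \<longrightarrow>
        prob_space M \<longrightarrow>
        (\<forall>n. T n \<in> M \<rightarrow>\<^sub>M PiM {..<n} (\<lambda>_. data_space d)) \<longrightarrow>
        (\<forall>n. (\<lambda>(t, x). q n t x)
               \<in> PiM {..<n} (\<lambda>_. data_space d) \<Otimes>\<^sub>M euclid d \<rightarrow>\<^sub>M unit_cube d) \<longrightarrow>
        (\<forall>n. (\<lambda>(t, x). \<delta> n t x)
               \<in> PiM {..<n} (\<lambda>_. data_space d) \<Otimes>\<^sub>M euclid d \<rightarrow>\<^sub>M bin_cube d) \<longrightarrow>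
        (\<forall>n. \<forall>t\<in>space (PiM {..<n} (\<lambda>_. data_space d)). rank_iou_rule \<gamma> d (q n t) (\<delta> n t)) \<longrightarrow>
        (\<forall>n. 0 < \<epsilon> n) \<longrightarrow>
        big_O_P M (\<lambda>n w. ce_excess d P p (q n (T n w))) \<epsilon> \<longrightarrow>
        big_O_P M (\<lambda>n w. ereal (IoU \<gamma> d P \<delta>' - IoU \<gamma> d P (\<delta> n (T n w))))
          (\<lambda>n. sqrt (real d) * sqrt (\<epsilon> n)))"
proof (intro conjI exI[of _ "2 :: real"] allI impI, goal_cases)
  case 1
  show ?case by simp
next
  case (2 d P p q \<delta>' \<delta>)
  then interpret label_model d P p by unfold_locales
  show ?case using 2 assms by (intro IoU_regret_le) (auto simp: bayes_rule_def is_arg_max_def)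
next
  case (3 d P p \<delta>' M T q \<delta> \<epsilon>)
  then interpret label_model d P p by unfold_locales
  let ?D = "\<lambda>n. PiM {..<n} (\<lambda>_. data_space d)"
  have T: "T n w \<in> space (?D n)" if "w \<in> space M" for n w
    using measurable_space[OF 3(7)[rule_format] that] .
  have q: "q n t \<in> euclid d \<rightarrow>\<^sub>M unit_cube d" if "t \<in> space (?D n)" for n t
    using measurable_compose_Pair1[OF that 3(8)[rule_format]] by simp
  have \<delta>: "\<delta> n t \<in> euclid d \<rightarrow>\<^sub>M bin_cube d" if "t \<in> space (?D n)" for n t
    using 3(10)[rule_format, OF that] by (simp add: rank_iou_rule_def)
  \<comment> \<open>A Bayes rule makes the regret nonnegative, and the absolute value in
    \<open>big_O_P\<close> calls for this lower bound.\<close>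
  have max: "IoU \<gamma> d P \<rho> \<le> IoU \<gamma> d P \<delta>'" if "\<rho> \<in> euclid d \<rightarrow>\<^sub>M bin_cube d" for \<rho>
    using 3(5) that by (auto simp: bayes_rule_def is_arg_max_linorder)
  \<comment> \<open>The constant \<open>2 * sqrt (2 * C)\<close> is what remains of
    \<open>2 * sqrt (2 * d * (C * \<epsilon> n))\<close> once the rate
    \<open>sqrt d * sqrt (\<epsilon> n)\<close> is split off.\<close>
  show ?case
  proof (rule big_O_P_transfer[OF 3(6) 3(12), where f = "\<lambda>C. 2 * sqrt (2 * C)"])
    fix n
    have "(\<lambda>(w, x). (T n w, x)) \<in> M \<Otimes>\<^sub>M euclid d \<rightarrow>\<^sub>M ?D n \<Otimes>\<^sub>M euclid d"
      using 3(7)[rule_format, of n] by measurable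
    from measurable_compose[OF this 3(8)[rule_format]]
    have "(\<lambda>(w, x). q n (T n w) x) \<in> M \<Otimes>\<^sub>M euclid d \<rightarrow>\<^sub>M unit_cube d"
      by (simp add: case_prod_unfold)
    then show "(\<lambda>w. ce_excess d P p (q n (T n w))) \<in> borel_measurable M"
      by (rule measurable_ce_excess[OF sigma_finite_measure_axioms sets_P])
  next
    fix C n w
    assume C: "C > 0" and w: "w \<in> space M"
      and le: "\<bar>ce_excess d P p (q n (T n w))\<bar> \<le> ereal (C * \<epsilon> n)"
    note t = T[OF w, of n]
    have le_abs: "ce_excess d P p (q n (T n w)) \<le> ereal (C * \<epsilon> n)"
      using le by (cases "ce_excess d P p (q n (T n w))") auto
    have "IoU \<gamma> d P \<delta>' - IoU \<gamma> d P (\<delta> n (T n w))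
        \<le> 2 * (\<integral>z. l1_norm d (\<lambda>j. q n (T n w) (fst z) j - p (fst z) j) \<partial>P)"
      using 3(5) by (intro IoU_regret_le[OF assms 3(2) q[OF t] 3(10)[rule_format, OF t]])
        (simp add: bayes_rule_def is_arg_max_def)
    also have "\<dots> \<le> 2 * sqrt (2 * d * (C * \<epsilon> n))"
      using integral_l1_diff_le[OF q[OF t]] le_abs by simp
    also have "\<dots> = 2 * sqrt (2 * C) * (sqrt (real d) * sqrt (\<epsilon> n))"
      by (simp add: real_sqrt_mult)
    finally show "\<bar>ereal (IoU \<gamma> d P \<delta>' - IoU \<gamma> d P (\<delta> n (T n w)))\<bar>
        \<le> ereal (2 * sqrt (2 * C) * (sqrt (real d) * sqrt (\<epsilon> n)))"
      using max[OF \<delta>[OF t]] by simp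
  qed simp
qed

end
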